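(* There exist absolute constants $\rho\in(0,1)$ and $C>0$ with the following property. Given $\kappa,\tau\geq 1$, there is $n_0(\tau)$ such that for every $n\geq n_0(\tau)$ and every isotropic convex body $K$ in $\mathbb{R}^n$ which satisfies the entropy estimate $$\log N(K,tB_2^n)\leq \frac{\kappa n^2\log^2 n}{t^2}\quad\text{for all } t\geq \tau\sqrt{n\log n},$$ the following holds: if $q\geq 2$ satisfies $$2\leq q\leq \rho^2 n\quad\text{and}\quad I_1(K,Z_q^{\circ}(K))\leq \rho\, n L_K^2,$$ then $$L_K^2\leq C\kappa\sqrt{\frac{n}{q}}\,\log^2 n\,\max\left\{1,\frac{I_1(K,Z_q^{\circ}(K))}{\sqrt{qn}\,L_K^2}\right\}.$$
   Context: A convex body in $\mathbb{R}^n$ is a compact convex set with nonempty interior; $|\cdot|$ is volume. A convex body $K$ is isotropic if $|K|=1$, its center of mass is at the origin, and there is a constant $L_K>0$ (the isotropic constant of $K$) with $\int_K\langle x,\theta\rangle^2dx=L_K^2$ for every $\theta$ in the Euclidean unit sphere $S^{n-1}$. $B_2^n$ is the Euclidean unit ball. For $q\geq1$ and a convex body $K$ of volume $1$, the $L_q$-centroid body $Z_q(K)$ is the symmetric convex body with support function $h_{Z_q(K)}(y)=\left(\int_K|\langle x,y\rangle|^q dx\right)^{1/q}$, and $Z_q^\circ(K)$ is its polar body. Thus $$I_1(K,Z_q^\circ(K))=\int_K h_{Z_q(K)}(x)\,dx=\int_K\left(\int_K|\langle y,x\rangle|^q dy\right)^{1/q}dx.$$ The covering number $N(A,B)$ of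 nonempty sets $A,B$ is the smallest number of translates of $B$ whose union covers $A$; when $B$ is a multiple of the Euclidean ball, the centers of the translates are also required to belong to $A$. "Absolute constant" means a constant independent of $n$, $K$, $q$, $\kappa$, $\tau$. *)

theory Defs
  imports "HOL-Analysis.Analysis"
begin

text \<open>
  The dimension is quantified inside the theorem, after the absolute constants, so it cannot be
  a type. A vector of $R^n$ is an extensional function on \<open>{..<n}\<close>; \<open>Rn n\<close> is at the same time the
  carrier of \<open>powertop_real {..<n}\<close> (the usual topology) and the space of \<open>leb n\<close> (Lebesgue
  measure, on the Borel sets).
\<close>

definition Rn :: "nat \<Rightarrow> (nat \<Rightarrow> real) set"
  where "Rn n = {..<n} \<rightarrow>\<^sub>E UNIV"

definition leb :: "nat \<Rightarrow> (nat \<Rightarrow> real) measure"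
  where "leb n = Pi\<^sub>M {..<n} (\<lambda>_. lborel)"

definition vzero :: "nat \<Rightarrow> nat \<Rightarrow> real"
  where "vzero n = (\<lambda>i\<in>{..<n}. 0)"

definition vadd :: "nat \<Rightarrow> (nat \<Rightarrow> real) \<Rightarrow> (nat \<Rightarrow> real) \<Rightarrow> nat \<Rightarrow> real"
  where "vadd n x y = (\<lambda>i\<in>{..<n}. x i + y i)"

definition vscale :: "nat \<Rightarrow> real \<Rightarrow> (nat \<Rightarrow> real) \<Rightarrow> nat \<Rightarrow> real"
  where "vscale n c x = (\<lambda>i\<in>{..<n}. c * x i)"

definition vinner :: "nat \<Rightarrow> (nat \<Rightarrow> real) \<Rightarrow> (nat \<Rightarrow> real) \<Rightarrow> real"
  where "vinner n x y = (\<Sum>i<n. x i * y i)"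

definition unit_ball :: "nat \<Rightarrow> (nat \<Rightarrow> real) set"
  where "unit_ball n = {x \<in> Rn n. L2_set x {..<n} \<le> 1}"

definition unit_sphere :: "nat \<Rightarrow> (nat \<Rightarrow> real) set"
  where "unit_sphere n = {x \<in> Rn n. L2_set x {..<n} = 1}"

definition convex_body :: "nat \<Rightarrow> (nat \<Rightarrow> real) set \<Rightarrow> bool" where
  "convex_body n K \<longleftrightarrow>
     compactin (powertop_real {..<n}) K \<and>
     (\<forall>x\<in>K. \<forall>y\<in>K. \<forall>u\<ge>0. \<forall>v\<ge>0. u + v = 1 \<longrightarrow> vadd n (vscale n u x) (vscale n v y) \<in> K) \<and>
     powertop_real {..<n} interior_of K \<noteq> {}"

definition center_of_mass :: "nat \<Rightarrow> (nat \<Rightarrow> real) set \<Rightarrow> nat \<Rightarrow> real" where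
  "center_of_mass n K = (\<lambda>i\<in>{..<n}. (LINT x:K|leb n. x i) / measure (leb n) K)"

definition has_isotropic_const :: "nat \<Rightarrow> (nat \<Rightarrow> real) set \<Rightarrow> real \<Rightarrow> bool" where
  "has_isotropic_const n K L \<longleftrightarrow>
     L > 0 \<and> (\<forall>\<theta>\<in>unit_sphere n. (LINT x:K|leb n. (vinner n x \<theta>)\<^sup>2) = L\<^sup>2)"

definition isotropic :: "nat \<Rightarrow> (nat \<Rightarrow> real) set \<Rightarrow> bool" where
  "isotropic n K \<longleftrightarrow>
     convex_body n K \<and> measure (leb n) K = 1 \<and> center_of_mass n K = vzero n \<and>
     (\<exists>L. has_isotropic_const n K L)"

definition isotropic_const :: "nat \<Rightarrow> (nat \<Rightarrow> real) set \<Rightarrow> real"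
  where "isotropic_const n K = (THE L. has_isotropic_const n K L)"

lemma isotropic_const_eq:
  assumes "n \<ge> 1" "has_isotropic_const n K L"
  shows "isotropic_const n K = L"
  unfolding isotropic_const_def
proof (rule the_equality)
  fix L' assume L': "has_isotropic_const n K L'"
  define e :: "nat \<Rightarrow> real" where "e = (\<lambda>i\<in>{..<n}. if i = 0 then 1 else 0)"
  have "L2_set e {..<n} = sqrt (\<Sum>i<n. if i = 0 then 1 else 0)"
    unfolding L2_set_def by (intro arg_cong[where f = sqrt] sum.cong) (auto simp: e_def)
  then have "e \<in> unit_sphere n"
    using assms(1) by (simp add: unit_sphere_def Rn_def e_def)
  then have "L'\<^sup>2 = L\<^sup>2"
    using assms(2) L' by (auto simp: has_isotropic_const_def)
  then show "L' = L"
    using assms(2) L' by (auto simp: has_isotropic_const_def)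
qed (fact assms(2))

text \<open>
  \<open>S\<close> is the set of admissible centers: \<open>Rn n\<close> for general \<open>A\<close> and \<open>B\<close>, and \<open>A\<close> itself when \<open>B\<close> is
  a multiple of the Euclidean ball.
\<close>

definition covering_number ::
    "nat \<Rightarrow> (nat \<Rightarrow> real) set \<Rightarrow> (nat \<Rightarrow> real) set \<Rightarrow> (nat \<Rightarrow> real) set \<Rightarrow> nat" where
  "covering_number n S A B =
     (LEAST m. \<exists>F\<subseteq>S. finite F \<and> card F = m \<and> A \<subseteq> (\<Union>c\<in>F. vadd n c ` B))"

definition support_fun :: "nat \<Rightarrow> (nat \<Rightarrow> real) set \<Rightarrow> (nat \<Rightarrow> real) \<Rightarrow> real"
  where "support_fun n A y = (SUP x\<in>A. vinner n x y)"

definition polar :: "nat \<Rightarrow> (nat \<Rightarrow> real) set \<Rightarrow> (nat \<Rightarrow> real) set"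
  where "polar n A = {y \<in> Rn n. \<forall>x\<in>A. vinner n x y \<le> 1}"

definition minkowski_gauge :: "nat \<Rightarrow> (nat \<Rightarrow> real) set \<Rightarrow> (nat \<Rightarrow> real) \<Rightarrow> real"
  where "minkowski_gauge n A x = Inf {t. t > 0 \<and> x \<in> vscale n t ` A}"

definition centroid_fun :: "nat \<Rightarrow> real \<Rightarrow> (nat \<Rightarrow> real) set \<Rightarrow> (nat \<Rightarrow> real) \<Rightarrow> real" where
  "centroid_fun n q K y = (LINT x:K|leb n. \<bar>vinner n x y\<bar> powr q) powr (1 / q)"

text \<open>
  The closed convex set with support function \<open>centroid_fun n q K\<close>; that this is indeed its
  support function is lemma \<open>support_fun_centroid_body\<close> below.
\<close>

definition centroid_body :: "nat \<Rightarrow> real \<Rightarrow> (nat \<Rightarrow> real) set \<Rightarrow> (nat \<Rightarrow> real) set" where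
  "centroid_body n q K = {x \<in> Rn n. \<forall>y\<in>Rn n. vinner n x y \<le> centroid_fun n q K y}"

text \<open>$I_1(K,C)$ is the mean over \<open>K\<close> of the norm with unit ball \<open>C\<close>.\<close>

definition I1 :: "nat \<Rightarrow> (nat \<Rightarrow> real) set \<Rightarrow> (nat \<Rightarrow> real) set \<Rightarrow> real"
  where "I1 n K C = (LINT x:K|leb n. minkowski_gauge n C x)"

lemma space_leb: "space (leb n) = Rn n"
  by (simp add: leb_def Rn_def space_PiM)

lemma compactin_sets_leb:
  assumes "compactin (powertop_real {..<n}) K"
  shows "K \<in> sets (leb n)"
proof -
  define e :: "(nat \<Rightarrow> real) \<Rightarrow> nat \<Rightarrow> real" where "e x i = (if i < n then x i else 0)" for x i
  have KR: "K \<subseteq> Rn n"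
    using compactin_subset_topspace[OF assms] by (simp add: Rn_def)
  have "continuous_map (powertop_real {..<n}) (powertop_real UNIV) e"
    unfolding continuous_map_componentwise_UNIV
  proof
    fix i
    show "continuous_map (powertop_real {..<n}) euclideanreal (\<lambda>x. e x i)"
      by (cases "i < n") (auto simp: e_def intro: continuous_map_product_projection)
  qed
  then have "compact (e ` K)"
    using image_compactin[OF assms, of "powertop_real UNIV" e] by (simp add: euclidean_product_topology)
  then have "e ` K \<in> sets borel"
    by (intro borel_closed compact_imp_closed)
  then have "e ` K \<in> sets (Pi\<^sub>M UNIV (\<lambda>_. borel))"
    using sets_PiM_equal_borel by blast
  moreover have "e \<in> leb n \<rightarrow>\<^sub>M Pi\<^sub>M UNIV (\<lambda>_. borel)"
  proof (rule measurable_PiM_single')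
    fix i :: nat
    show "(\<lambda>x. e x i) \<in> borel_measurable (leb n)"
    proof (cases "i < n")
      case True
      then have "(\<lambda>x. x i) \<in> borel_measurable (leb n)"
        unfolding leb_def by simp
      then show ?thesis using True by (simp add: e_def)
    qed (simp add: e_def)
  qed simp
  ultimately have "e -` (e ` K) \<inter> space (leb n) \<in> sets (leb n)"
    by (rule measurable_sets[rotated])
  moreover have "e -` (e ` K) \<inter> space (leb n) = K"
  proof -
    have "x = y" if "x \<in> Rn n" "y \<in> Rn n" "e x = e y" for x y
    proof
      fix i show "x i = y i"
        using that(1,2) fun_cong[OF that(3), of i] by (cases "i < n") (auto simp: e_def Rn_def PiE_def extensional_def)
    qed
    then show ?thesis using KR by (auto simp: space_leb)
  qed
  ultimately show ?thesis by simp
qed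

lemma vinner_measurable: "(\<lambda>x. vinner n x y) \<in> borel_measurable (leb n)"
  unfolding vinner_def leb_def by measurable

lemma coord_measurable: "i < n \<Longrightarrow> (\<lambda>x. x i) \<in> borel_measurable (leb n)"
  unfolding leb_def by measurable

lemma compactin_bounded:
  assumes "compactin (powertop_real {..<n}) K" "i < n"
  shows "\<exists>B. \<forall>x\<in>K. \<bar>x i\<bar> \<le> B"
proof -
  have "compactin euclideanreal ((\<lambda>x. x i) ` K)"
    by (rule image_compactin[OF assms(1)]) (use assms(2) in \<open>auto intro: continuous_map_product_projection\<close>)
  then have "bounded ((\<lambda>x. x i) ` K)" by (simp add: compact_imp_bounded)
  then show ?thesis by (auto simp: bounded_iff)
qed

lemma set_integrable_leb:
  fixes f :: "(nat \<Rightarrow> real) \<Rightarrow> real"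
  assumes "convex_body n K" "measure (leb n) K = 1" "f \<in> borel_measurable (leb n)"
    and "\<And>x. x \<in> K \<Longrightarrow> \<bar>f x\<bar> \<le> B"
  shows "set_integrable (leb n) K f"
  unfolding set_integrable_def
proof (rule integrableI_bounded_set_indicator[where B = B])
  show "K \<in> sets (leb n)" using assms(1) by (simp add: convex_body_def compactin_sets_leb)
  show "emeasure (leb n) K < \<infinity>"
    using assms(2) by (metis enn2real_top ennreal_top_neq_one infinity_ennreal_def less_top
        measure_def top.not_eq_extremum zero_neq_one)
qed (use assms in auto)

lemma vinner_bounded:
  assumes "convex_body n K"
  shows "\<exists>B. \<forall>x\<in>K. \<bar>vinner n x y\<bar> \<le> B"
proof -
  have "\<forall>i\<in>{..<n}. \<exists>B. \<forall>x\<in>K. \<bar>x i\<bar> \<le> B"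
    using assms compactin_bounded by (auto simp: convex_body_def)
  then obtain b where b: "\<And>i x. i < n \<Longrightarrow> x \<in> K \<Longrightarrow> \<bar>x i\<bar> \<le> b i"
    by (metis lessThan_iff)
  have "\<bar>vinner n x y\<bar> \<le> (\<Sum>i<n. b i * \<bar>y i\<bar>)" if "x \<in> K" for x
    unfolding vinner_def using b that
    by (intro order_trans[OF sum_abs] sum_mono) (auto simp: abs_mult intro!: mult_right_mono)
  then show ?thesis by blast
qed

lemma integrable_vinner_powr:
  assumes "convex_body n K" "measure (leb n) K = 1" "q \<ge> 1"
  shows "set_integrable (leb n) K (\<lambda>x. \<bar>vinner n x y\<bar> powr q)"
proof -
  obtain B where "\<forall>x\<in>K. \<bar>vinner n x y\<bar> \<le> B" using vinner_bounded[OF assms(1)] by blast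
  then show ?thesis
    using assms(3) vinner_measurable[of n y]
    by (intro set_integrable_leb[OF assms(1,2), where B = "B powr q"]) (auto intro!: powr_mono2)
qed

lemma centroid_fun_nonneg: "centroid_fun n q K y \<ge> 0"
  by (simp add: centroid_fun_def)

lemma centroid_fun_powr:
  assumes "q \<ge> 1"
  shows "centroid_fun n q K y powr q = (LINT x:K|leb n. \<bar>vinner n x y\<bar> powr q)"
proof -
  have "0 \<le> (LINT x:K|leb n. \<bar>vinner n x y\<bar> powr q)"
    unfolding set_lebesgue_integral_def by (intro integral_nonneg_AE) auto
  then show ?thesis
    using assms by (simp add: centroid_fun_def powr_powr)
qed

lemma young_scaled:
  fixes a b N s q :: real
  assumes "q \<ge> 1" "N > 0" "s > 0"
  shows "\<bar>a\<bar> powr (q - 1) * \<bar>b\<bar> \<le>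
    N powr (q - 1) * s * ((1 - 1/q) * (\<bar>a\<bar> powr q / N powr q) + (1/q) * (\<bar>b\<bar> powr q / s powr q))"
proof (cases "a = 0 \<or> b = 0")
  case True
  have "0 \<le> N powr (q - 1) * s * ((1 - 1/q) * (\<bar>a\<bar> powr q / N powr q) + (1/q) * (\<bar>b\<bar> powr q / s powr q))"
    using assms by (intro mult_nonneg_nonneg add_nonneg_nonneg) auto
  then show ?thesis using True by auto
next
  case False
  define A where "A = \<bar>a\<bar> / N"
  define B where "B = \<bar>b\<bar> / s"
  have pos: "A > 0" "B > 0" using False assms by (auto simp: A_def B_def)
  have "(A powr q) powr (1 - 1/q) * (B powr q) powr (1/q) \<le> (1 - 1/q) * A powr q + 1/q * B powr q"
    using assms pos by (intro Youngs_inequality_0) auto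
  moreover have "(A powr q) powr (1 - 1/q) = A powr (q - 1)" "(B powr q) powr (1/q) = B"
    using assms pos by (auto simp: powr_powr right_diff_distrib)
  ultimately have *: "A powr (q - 1) * B \<le> (1 - 1/q) * A powr q + 1/q * B powr q" by simp
  have "\<bar>a\<bar> powr (q - 1) * \<bar>b\<bar> = N powr (q - 1) * s * (A powr (q - 1) * B)"
    using assms by (simp add: A_def B_def powr_divide)
  also have "\<dots> \<le> N powr (q - 1) * s * ((1 - 1/q) * A powr q + 1/q * B powr q)"
    using * assms by (intro mult_left_mono) auto
  finally show ?thesis using assms by (simp add: A_def B_def powr_divide)
qed

lemma centroid_fun_holder:
  fixes g :: "(nat \<Rightarrow> real) \<Rightarrow> real"
  assumes K: "convex_body n K" "measure (leb n) K = 1" and q: "q \<ge> 1"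
    and N: "centroid_fun n q K y > 0"
    and g: "g = (\<lambda>x. sgn (vinner n x y) * \<bar>vinner n x y\<bar> powr (q - 1))"
  shows "(LINT x:K|leb n. g x * vinner n x w) \<le>
    centroid_fun n q K y powr (q - 1) * centroid_fun n q K w"
    and "\<And>i. i < n \<Longrightarrow> set_integrable (leb n) K (\<lambda>x. g x * x i)"
proof -
  let ?N = "centroid_fun n q K"
  obtain By where By: "\<forall>x\<in>K. \<bar>vinner n x y\<bar> \<le> By" using vinner_bounded[OF K(1)] by blast
  have gb: "\<bar>g x\<bar> \<le> By powr (q - 1)" if "x \<in> K" for x
  proof -
    have "\<bar>g x\<bar> \<le> \<bar>vinner n x y\<bar> powr (q - 1)"
      by (auto simp: g abs_mult abs_sgn_eq)
    also have "\<dots> \<le> By powr (q - 1)" using By that q by (intro powr_mono2) auto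
    finally show ?thesis .
  qed
  have gm [measurable]: "g \<in> borel_measurable (leb n)"
    using vinner_measurable[of n y] unfolding g by measurable
  show "set_integrable (leb n) K (\<lambda>x. g x * x i)" if "i < n" for i
  proof -
    obtain B where B: "\<forall>x\<in>K. \<bar>x i\<bar> \<le> B"
      using compactin_bounded[of n K i] K(1) \<open>i < n\<close> unfolding convex_body_def by blast
    show ?thesis
      by (rule set_integrable_leb[OF K, where B = "By powr (q - 1) * B"])
        (use gb B coord_measurable[OF that] in \<open>auto simp: abs_mult intro!: mult_mono\<close>)
  qed
  obtain Bw where Bw: "\<forall>x\<in>K. \<bar>vinner n x w\<bar> \<le> Bw" using vinner_bounded[OF K(1)] by blast
  have gi: "set_integrable (leb n) K (\<lambda>x. g x * vinner n x w)"
    by (rule set_integrable_leb[OF K, where B = "By powr (q - 1) * Bw"])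
      (use gb Bw vinner_measurable[of n w] in \<open>auto simp: abs_mult intro!: mult_mono\<close>)
  have le: "(LINT x:K|leb n. g x * vinner n x w) \<le> ?N y powr (q - 1) * s" if s: "s > ?N w" for s
  proof -
    have s0: "s > 0" using s centroid_fun_nonneg[of n q K w] by linarith
    let ?c1 = "?N y powr (q - 1) * s * (1 - 1/q) / ?N y powr q"
    let ?c2 = "?N y powr (q - 1) * s * (1/q) / s powr q"
    let ?f1 = "\<lambda>x. \<bar>vinner n x y\<bar> powr q" and ?f2 = "\<lambda>x. \<bar>vinner n x w\<bar> powr q"
    note i1 = integrable_vinner_powr[OF K q, of y]
    note i2 = integrable_vinner_powr[OF K q, of w]
    have j1: "set_integrable (leb n) K (\<lambda>x. ?c1 * ?f1 x)" using i1 by (intro set_integrable_mult_right) auto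
    have j2: "set_integrable (leb n) K (\<lambda>x. ?c2 * ?f2 x)" using i2 by (intro set_integrable_mult_right) auto
    have "(LINT x:K|leb n. g x * vinner n x w) \<le> (LINT x:K|leb n. ?c1 * ?f1 x + ?c2 * ?f2 x)"
    proof (rule set_integral_mono[OF gi])
      show "set_integrable (leb n) K (\<lambda>x. ?c1 * ?f1 x + ?c2 * ?f2 x)"
        using set_integral_add(1)[OF j1 j2] .
      fix x
      have "g x * vinner n x w \<le> \<bar>g x * vinner n x w\<bar>" by simp
      also have "\<dots> \<le> \<bar>vinner n x y\<bar> powr (q - 1) * \<bar>vinner n x w\<bar>"
        unfolding abs_mult g by (intro mult_right_mono) (auto simp: abs_sgn_eq)
      also have "\<dots> \<le> ?c1 * ?f1 x + ?c2 * ?f2 x"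
        using young_scaled[OF q N s0, of "vinner n x y" "vinner n x w"] by (simp add: algebra_simps)
      finally show "g x * vinner n x w \<le> ?c1 * ?f1 x + ?c2 * ?f2 x" .
    qed
    also have "\<dots> = ?c1 * ?N y powr q + ?c2 * ?N w powr q"
      using set_integral_add(2)[OF j1 j2] centroid_fun_powr[OF q] by simp
    also have "\<dots> \<le> ?c1 * ?N y powr q + ?c2 * s powr q"
      using s q s0 centroid_fun_nonneg[of n q K w]
      by (intro add_left_mono mult_left_mono powr_mono2) auto
    also have "\<dots> = ?N y powr (q - 1) * s"
      using N s0 q by (simp add: field_simps)
    finally show ?thesis .
  qed
  have N': "?N y powr (q - 1) > 0" using N by simp
  have "(LINT x:K|leb n. g x * vinner n x w) / ?N y powr (q - 1) \<le> ?N w"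
  proof (rule dense_ge)
    fix s assume "?N w < s"
    from le[OF this] show "(LINT x:K|leb n. g x * vinner n x w) / ?N y powr (q - 1) \<le> s"
      using N' by (simp add: field_simps)
  qed
  then show "(LINT x:K|leb n. g x * vinner n x w) \<le> ?N y powr (q - 1) * ?N w"
    using N' by (simp add: field_simps)
qed

lemma centroid_body_touch:
  assumes K: "convex_body n K" "measure (leb n) K = 1" and q: "q \<ge> 1"
  shows "\<exists>v\<in>centroid_body n q K. vinner n v y = centroid_fun n q K y"
proof (cases "centroid_fun n q K y = 0")
  case True
  then show ?thesis
    by (intro bexI[of _ "vzero n"])
      (auto simp: centroid_body_def vzero_def vinner_def Rn_def centroid_fun_nonneg)
next
  case False
  let ?N = "centroid_fun n q K"
  have N: "?N y > 0" using False centroid_fun_nonneg[of n q K y] by linarith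
  define g where "g = (\<lambda>x. sgn (vinner n x y) * \<bar>vinner n x y\<bar> powr (q - 1))"
  define v where "v = (\<lambda>i\<in>{..<n}. (LINT x:K|leb n. g x * x i) / ?N y powr (q - 1))"
  note H = centroid_fun_holder[OF K q N g_def]
  have v: "vinner n v w = (LINT x:K|leb n. g x * vinner n x w) / ?N y powr (q - 1)" for w
  proof -
    have "(LINT x:K|leb n. g x * vinner n x w) =
        (\<integral>x. (\<Sum>i<n. w i * (indicator K x *\<^sub>R (g x * x i))) \<partial>leb n)"
      unfolding set_lebesgue_integral_def vinner_def
      by (intro Bochner_Integration.integral_cong) (auto simp: sum_distrib_left algebra_simps)
    also have "\<dots> = (\<Sum>i<n. w i * (LINT x:K|leb n. g x * x i))"
      unfolding set_lebesgue_integral_def using H(2)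
      by (subst Bochner_Integration.integral_sum) (auto simp: set_integrable_def)
    finally show ?thesis
      by (simp add: vinner_def v_def sum_divide_distrib mult.commute)
  qed
  have "vinner n v w \<le> ?N w" for w
    using H(1)[of w] N by (simp add: v field_simps)
  moreover have "v \<in> Rn n"
    by (simp add: Rn_def v_def)
  ultimately have "v \<in> centroid_body n q K"
    by (simp add: centroid_body_def)
  moreover have "vinner n v y = ?N y"
  proof -
    have "g x * vinner n x y = \<bar>vinner n x y\<bar> powr q" for x
    proof (cases "vinner n x y = 0")
      case False
      have "g x * vinner n x y = \<bar>vinner n x y\<bar> * \<bar>vinner n x y\<bar> powr (q - 1)"
        by (simp add: g_def abs_sgn[of "vinner n x y"] mult_ac)
      also have "\<dots> = \<bar>vinner n x y\<bar> powr q"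
        using False by (simp add: powr_mult_base)
      finally show ?thesis .
    qed simp
    then have "vinner n v y = ?N y powr q / ?N y powr (q - 1)"
      by (simp add: v centroid_fun_powr[OF q])
    also have "\<dots> = ?N y" using N by (simp flip: powr_diff)
    finally show ?thesis .
  qed
  ultimately show ?thesis by blast
qed

lemma support_fun_centroid_body:
  assumes "convex_body n K" "measure (leb n) K = 1" "q \<ge> 1" "y \<in> Rn n"
  shows "support_fun n (centroid_body n q K) y = centroid_fun n q K y"
proof -
  obtain v where v: "v \<in> centroid_body n q K" "vinner n v y = centroid_fun n q K y"
    using centroid_body_touch[OF assms(1-3)] by blast
  then show ?thesis
    unfolding support_fun_def using assms(4)
    by (intro cSup_eq_maximum) (auto simp: centroid_body_def image_iff intro!: bexI[of _ v])
qed

lemma minkowski_gauge_polar_centroid_body: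
  assumes "convex_body n K" "measure (leb n) K = 1" "q \<ge> 1" "x \<in> Rn n"
  shows "minkowski_gauge n (polar n (centroid_body n q K)) x = centroid_fun n q K x"
proof -
  obtain v where v: "v \<in> centroid_body n q K" "vinner n v x = centroid_fun n q K x"
    using centroid_body_touch[OF assms(1-3)] by blast
  have "x \<in> vscale n t ` polar n (centroid_body n q K) \<longleftrightarrow> centroid_fun n q K x \<le> t"
    if t: "t > 0" for t
  proof
    assume "x \<in> vscale n t ` polar n (centroid_body n q K)"
    then obtain z where z: "z \<in> polar n (centroid_body n q K)" "x = vscale n t z" by blast
    have "vinner n v x = t * vinner n v z"
      by (simp add: z(2) vinner_def vscale_def sum_distrib_left mult_ac)
    also have "\<dots> \<le> t * 1" using z(1) v(1) t by (intro mult_left_mono) (auto simp: polar_def)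
    finally show "centroid_fun n q K x \<le> t" using v(2) by simp
  next
    assume le: "centroid_fun n q K x \<le> t"
    let ?z = "vscale n (1/t) x"
    have "vinner n u ?z = vinner n u x / t" for u
      by (simp add: vinner_def vscale_def sum_divide_distrib)
    moreover have "vinner n u x \<le> t" if "u \<in> centroid_body n q K" for u
      using that le assms(4) by (force simp: centroid_body_def)
    ultimately have "?z \<in> polar n (centroid_body n q K)"
      using t by (auto simp: polar_def vscale_def Rn_def)
    moreover have "x = vscale n t ?z"
      using t assms(4) by (auto simp: vscale_def Rn_def PiE_def extensional_def fun_eq_iff)
    ultimately show "x \<in> vscale n t ` polar n (centroid_body n q K)" by blast
  qed
  then have eq: "{t. t > 0 \<and> x \<in> vscale n t ` polar n (centroid_body n q K)} =
      {t. t > 0 \<and> centroid_fun n q K x \<le> t}"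
    by blast
  show ?thesis
    unfolding minkowski_gauge_def eq
  proof (rule cInf_eq)
    fix b assume b: "\<And>t. t \<in> {t. t > 0 \<and> centroid_fun n q K x \<le> t} \<Longrightarrow> b \<le> t"
    show "b \<le> centroid_fun n q K x"
      by (rule dense_ge) (use b centroid_fun_nonneg[of n q K x] in auto)
  qed auto
qed

lemma I1_polar_centroid_body:
  assumes "convex_body n K" "measure (leb n) K = 1" "q \<ge> 1"
  shows "I1 n K (polar n (centroid_body n q K)) = (LINT x:K|leb n. centroid_fun n q K x)"
proof -
  have "K \<subseteq> Rn n"
    using assms(1) compactin_subset_topspace by (fastforce simp: convex_body_def Rn_def)
  then show ?thesis
    unfolding I1_def set_lebesgue_integral_def
    using minkowski_gauge_polar_centroid_body[OF assms]
    by (intro Bochner_Integration.integral_cong) (auto simp: indicator_def)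
qed

end

theory Submission
  imports Defs
begin

text \<open>
  Write \<open>h\<close> and \<open>h'\<close> for the support functions of the centroid bodies with exponents \<open>q\<close> and \<open>p\<close>.
  By the midpoint Prekopa--Leindler inequality the tails of a linear functional on \<open>K\<close> are
  log-concave, which gives the reverse Hoelder inequality \<open>h' \<le> c (p / q) h\<close> for \<open>2 \<le> q \<le> p\<close> and
  bounds the fourth moment of the Euclidean norm. Hence the part \<open>A\<close> of \<open>K\<close> on which \<open>h\<close> is at most
  a constant multiple of $I_1$ still carries half of $\int_K |x|^2 = n L^2$. Cover \<open>A\<close> by
  \<open>N\<close> balls of radius \<open>r = sqrt n L / 8\<close> and move the centers into \<open>A\<close>: up to errors of order \<open>n L^2 / 4\<close>,
  $|x|^2$ on \<open>A\<close> is at most the maximum of $|\langle x, z\rangle|$ over the centers \<open>z\<close>, whose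
  integral is at most a constant times the maximum of \<open>h' z\<close> as soon as \<open>p \<ge> ln N\<close>. With
  \<open>p = max q (ln N)\<close> this reads $n L^2 \le C (p / q) I_1$. If \<open>p = q\<close> it contradicts the hypothesis
  on $I_1$; otherwise the entropy estimate at \<open>r\<close> bounds \<open>p\<close>. When \<open>r\<close> is too small for the entropy
  estimate, \<open>L\<close> itself is small.
\<close>

section \<open>The midpoint Prekopa--Leindler inequality\<close>

text \<open>Take \<open>a\<close> in \<open>A\<close> near its right end and \<open>b\<close> in
  \<open>B\<close> near its left end. The midpoints of \<open>A\<close> with \<open>b\<close> to the
  left of \<open>(a + b) / 2\<close> and the midpoints of \<open>B\<close> with \<open>a\<close> to
  the right of it form disjoint subsets of \<open>C\<close>. The ends need not be attained, hence
  the slack \<open>e\<close>.\<close>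

lemma brunn_minkowski_midpoint_real:
  fixes A B C :: "real set"
  assumes [measurable]: "A \<in> sets borel" "B \<in> sets borel" "C \<in> sets borel"
    and ne: "A \<noteq> {}" "B \<noteq> {}" and bd: "bounded A" "bounded B"
    and mid: "\<And>x y. x \<in> A \<Longrightarrow> y \<in> B \<Longrightarrow> (x + y) / 2 \<in> C"
  shows "emeasure lborel A + emeasure lborel B \<le> 2 * emeasure lborel C"
proof (rule ennreal_le_epsilon)
  fix e :: real assume e: "0 < e"
  have bA: "bdd_above A" and bB: "bdd_below B"
    using bd by (auto intro: bounded_imp_bdd_above bounded_imp_bdd_below)
  obtain a where a: "a \<in> A" "Sup A - e/2 < a"
    using less_cSup_iff[OF ne(1) bA, of "Sup A - e/2"] e by auto
  obtain b where b: "b \<in> B" "b < Inf B + e/2"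
    using cInf_less_iff[OF ne(2) bB, of "Inf B + e/2"] e by auto
  \<comment> \<open>Halved translates of the two pieces: \<open>z\<close> is the midpoint of
    \<open>b\<close> and \<open>- b + 2 * z\<close>, and of \<open>a\<close> and
    \<open>- a + 2 * z\<close>. They are disjoint because \<open>z < (a + b) / 2\<close> on
    \<open>X\<close> and \<open>(a + b) / 2 \<le> z\<close> on \<open>Y\<close>.\<close>
  define X where "X = {z. - b + 2 * z \<in> A \<inter> {..<a}}"
  define Y where "Y = {z. - a + 2 * z \<in> B \<inter> {b..}}"
  have [measurable]: "X \<in> sets borel" "Y \<in> sets borel"
    unfolding X_def Y_def by measurable
  have X: "emeasure lborel (A \<inter> {..<a}) = 2 * emeasure lborel X"
  proof -
    have "emeasure lborel (A \<inter> {..<a}) = (\<integral>\<^sup>+x. indicator (A \<inter> {..<a}) x \<partial>lborel)"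
      by simp
    also have "\<dots> = 2 * (\<integral>\<^sup>+x. indicator (A \<inter> {..<a}) (- b + 2 * x) \<partial>lborel)"
      by (subst nn_integral_real_affine[where c = 2 and t = "-b"]) auto
    also have "(\<lambda>x. indicator (A \<inter> {..<a}) (- b + 2 * x) :: ennreal) = indicator X"
      by (auto simp: X_def indicator_def)
    finally show ?thesis by simp
  qed
  have Y: "emeasure lborel (B \<inter> {b..}) = 2 * emeasure lborel Y"
  proof -
    have "emeasure lborel (B \<inter> {b..}) = (\<integral>\<^sup>+x. indicator (B \<inter> {b..}) x \<partial>lborel)"
      by simp
    also have "\<dots> = 2 * (\<integral>\<^sup>+x. indicator (B \<inter> {b..}) (- a + 2 * x) \<partial>lborel)"
      by (subst nn_integral_real_affine[where c = 2 and t = "-a"]) auto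
    also have "(\<lambda>x. indicator (B \<inter> {b..}) (- a + 2 * x) :: ennreal) = indicator Y"
      by (auto simp: Y_def indicator_def)
    finally show ?thesis by simp
  qed
  have "X \<inter> Y = {}" by (auto simp: X_def Y_def)
  then have "emeasure lborel X + emeasure lborel Y = emeasure lborel (X \<union> Y)"
    by (intro plus_emeasure) auto
  also have "\<dots> \<le> emeasure lborel C"
  proof (intro emeasure_mono subsetI)
    fix z assume "z \<in> X \<union> Y"
    then show "z \<in> C"
      using mid[OF _ b(1), of "- b + 2 * z"] mid[OF a(1), of "- a + 2 * z"] by (auto simp: X_def Y_def)
  qed simp
  finally have XY: "emeasure lborel X + emeasure lborel Y \<le> emeasure lborel C" .
  \<comment> \<open>Cutting \<open>A\<close> at \<open>a\<close> loses at most the interval from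
    \<open>a\<close> to \<open>Sup A\<close>, shorter than \<open>e/2\<close>; the same holds for
    \<open>B\<close> at \<open>b\<close>.\<close>
  have "emeasure lborel A \<le> emeasure lborel ((A \<inter> {..<a}) \<union> {a..Sup A})"
    using cSup_upper[OF _ bA] by (intro emeasure_mono) auto
  also have "\<dots> \<le> emeasure lborel (A \<inter> {..<a}) + emeasure lborel {a..Sup A}"
    by (intro emeasure_subadditive) auto
  also have "emeasure lborel {a..Sup A} \<le> ennreal (e/2)"
    using a cSup_upper[OF a(1) bA] by (auto intro!: ennreal_leI)
  finally have A: "emeasure lborel A \<le> emeasure lborel (A \<inter> {..<a}) + ennreal (e/2)"
    by (simp add: add_left_mono)
  have "emeasure lborel B \<le> emeasure lborel ((B \<inter> {b..}) \<union> {Inf B..b})"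
    using cInf_lower[OF _ bB] by (intro emeasure_mono) auto
  also have "\<dots> \<le> emeasure lborel (B \<inter> {b..}) + emeasure lborel {Inf B..b}"
    by (intro emeasure_subadditive) auto
  also have "emeasure lborel {Inf B..b} \<le> ennreal (e/2)"
    using b cInf_lower[OF b(1) bB] by (auto intro!: ennreal_leI)
  finally have B: "emeasure lborel B \<le> emeasure lborel (B \<inter> {b..}) + ennreal (e/2)"
    by (simp add: add_left_mono)
  have "emeasure lborel A + emeasure lborel B \<le>
      (emeasure lborel (A \<inter> {..<a}) + ennreal (e/2)) + (emeasure lborel (B \<inter> {b..}) + ennreal (e/2))"
    by (intro add_mono A B)
  also have "\<dots> = 2 * (emeasure lborel X + emeasure lborel Y) + (ennreal (e/2) + ennreal (e/2))"
    by (simp add: X Y algebra_simps)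
  also have "ennreal (e/2) + ennreal (e/2) = ennreal e"
    using e by (subst ennreal_plus[symmetric]) auto
  also have "2 * (emeasure lborel X + emeasure lborel Y) + ennreal e \<le> 2 * emeasure lborel C + ennreal e"
    by (intro add_right_mono mult_left_mono XY) auto
  finally show "emeasure lborel A + emeasure lborel B \<le> 2 * emeasure lborel C + ennreal e" .
qed

text \<open>Fubini on the region under the graph. Cutting at height 1 leaves exactly the levels at
  which normalized functions have nonempty superlevel sets, so that the inequality for sets applies
  at each of them.\<close>

lemma layer_cake_unit:
  fixes f :: "real \<Rightarrow> real"
  assumes [measurable]: "f \<in> borel_measurable borel"
  shows "(\<integral>\<^sup>+x. ennreal (min 1 (f x)) \<partial>lborel) =
    (\<integral>\<^sup>+t. emeasure lborel {x. t < f x} * indicator {0..<1} t \<partial>lborel)"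
proof -
  let ?i = "\<lambda>x t. indicator {x. t < f x} x * indicator {0..<1} t :: ennreal"
  have "ennreal (min 1 (f x)) = (\<integral>\<^sup>+t. ?i x t \<partial>lborel)" for x
  proof -
    have "(\<integral>\<^sup>+t. ?i x t \<partial>lborel) = (\<integral>\<^sup>+t. indicator {0..<min 1 (f x)} t \<partial>lborel)"
      by (intro nn_integral_cong) (auto simp: indicator_def)
    also have "\<dots> = ennreal (min 1 (f x))"
      by (cases "0 \<le> f x") (auto simp: ennreal_neg)
    finally show ?thesis by simp
  qed
  then have "(\<integral>\<^sup>+x. ennreal (min 1 (f x)) \<partial>lborel) = (\<integral>\<^sup>+x. (\<integral>\<^sup>+t. ?i x t \<partial>lborel) \<partial>lborel)"
    by simp
  also have "\<dots> = (\<integral>\<^sup>+t. (\<integral>\<^sup>+x. ?i x t \<partial>lborel) \<partial>lborel)"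
    by (intro lborel_pair.Fubini'[symmetric]) (simp add: indicator_def, measurable)
  also have "\<dots> = (\<integral>\<^sup>+t. emeasure lborel {x. t < f x} * indicator {0..<1} t \<partial>lborel)"
    by (intro nn_integral_cong) (simp add: nn_integral_multc)
  finally show ?thesis .
qed

text \<open>The arithmetic-geometric mean inequality; it takes the additive form of
  Prekopa--Leindler to the multiplicative one.\<close>

lemma ennreal_mult_le_square_of_add_le:
  fixes a b c :: ennreal
  assumes "a + b \<le> 2 * c"
  shows "a * b \<le> c\<^sup>2"
proof (cases "c = \<infinity>")
  case True
  then show ?thesis by (simp add: power2_eq_square ennreal_top_mult)
next
  case False
  then obtain r where r: "c = ennreal r" "r \<ge> 0" by (cases c) auto
  have c2: "2 * c = ennreal (2 * r)"
    using r by (simp add: ennreal_mult)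
  have "a + b < top"
    using assms unfolding c2 by (rule le_less_trans) simp
  then have "a < top" "b < top" by auto
  then obtain u v where u: "a = ennreal u" "u \<ge> 0" and v: "b = ennreal v" "v \<ge> 0"
    by (cases a; cases b) auto
  have le: "u + v \<le> 2 * r"
    using assms r u v unfolding c2 by (simp flip: ennreal_plus)
  have "4 * (u * v) \<le> (u + v)\<^sup>2" using zero_le_power2[of "u - v"] by (simp add: power2_eq_square algebra_simps)
  also have "\<dots> \<le> (2 * r)\<^sup>2" using le u v by (intro power_mono) auto
  finally have "u * v \<le> r\<^sup>2" by (simp add: power2_eq_square)
  then show ?thesis using r u v by (simp add: ennreal_power flip: ennreal_mult)
qed

text \<open>With both suprema equal to 1, the superlevel sets of \<open>f\<close> and
  \<open>g\<close> at any \<open>t\<close> in [0,1) are nonempty, and midpoints between them lie in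
  the superlevel set of \<open>h\<close> because \<open>f x * g y > t * t\<close>. The inequality
  for sets is then integrated over \<open>t\<close>.\<close>

lemma prekopa_leindler_midpoint_normalized:
  fixes f g h :: "real \<Rightarrow> real"
  assumes [measurable]: "f \<in> borel_measurable borel" "g \<in> borel_measurable borel" "h \<in> borel_measurable borel"
    and f: "\<And>x. 0 \<le> f x" "\<And>x. f x \<le> 1" "\<And>x. R < \<bar>x\<bar> \<Longrightarrow> f x = 0" "\<And>t. t < 1 \<Longrightarrow> \<exists>x. t < f x"
    and g: "\<And>x. 0 \<le> g x" "\<And>x. g x \<le> 1" "\<And>x. R < \<bar>x\<bar> \<Longrightarrow> g x = 0" "\<And>t. t < 1 \<Longrightarrow> \<exists>x. t < g x"
    and h: "\<And>x. 0 \<le> h x" "\<And>x y. f x * g y \<le> (h ((x + y) / 2))\<^sup>2"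
  shows "(\<integral>\<^sup>+x. f x \<partial>lborel) + (\<integral>\<^sup>+x. g x \<partial>lborel) \<le> 2 * (\<integral>\<^sup>+x. h x \<partial>lborel)"
proof -
  have lev: "emeasure lborel {x. t < f x} + emeasure lborel {x. t < g x} \<le> 2 * emeasure lborel {x. t < h x}"
    if t: "0 \<le> t" "t < 1" for t
  proof (rule brunn_minkowski_midpoint_real)
    have *: "x \<in> {-R..R}" if "t < f x \<or> t < g x" for x
    proof (rule ccontr)
      assume "x \<notin> {-R..R}"
      then have "R < \<bar>x\<bar>" by (auto simp: abs_real_def)
      then show False using f(3) g(3) that t by force
    qed
    show "bounded {x. t < f x}" "bounded {x. t < g x}"
      using * by (auto intro!: bounded_subset[OF bounded_closed_interval[of "-R" R]])
    fix x y assume xy: "x \<in> {x. t < f x}" "y \<in> {x. t < g x}"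
    then have "t * t < f x * g y" using t by (intro mult_strict_mono) auto
    also note h(2)
    finally have "t\<^sup>2 < (h ((x + y) / 2))\<^sup>2" by (simp add: power2_eq_square)
    then show "(x + y) / 2 \<in> {x. t < h x}"
      using h(1) power_less_imp_less_base by blast
  qed (use f(4) g(4) t in auto)
  have "(\<integral>\<^sup>+x. f x \<partial>lborel) + (\<integral>\<^sup>+x. g x \<partial>lborel) =
      (\<integral>\<^sup>+x. ennreal (min 1 (f x)) \<partial>lborel) + (\<integral>\<^sup>+x. ennreal (min 1 (g x)) \<partial>lborel)"
    using f(2) g(2) by (simp add: min_absorb2)
  also have "\<dots> = (\<integral>\<^sup>+t. (emeasure lborel {x. t < f x} + emeasure lborel {x. t < g x}) * indicator {0..<1} t \<partial>lborel)"
    by (simp add: layer_cake_unit nn_integral_add distrib_right)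
  also have "\<dots> \<le> (\<integral>\<^sup>+t. 2 * (emeasure lborel {x. t < h x} * indicator {0..<1} t) \<partial>lborel)"
    using lev by (intro nn_integral_mono) (auto simp: indicator_def)
  also have "\<dots> = 2 * (\<integral>\<^sup>+x. ennreal (min 1 (h x)) \<partial>lborel)"
    by (simp add: layer_cake_unit nn_integral_cmult)
  also have "\<dots> \<le> 2 * (\<integral>\<^sup>+x. h x \<partial>lborel)"
    by (intro mult_left_mono nn_integral_mono ennreal_leI) auto
  finally show ?thesis .
qed



text \<open>By homogeneity, \<open>f\<close> and \<open>g\<close> may be divided by their suprema
  \<open>\<alpha>\<close>, \<open>\<beta>\<close> and \<open>h\<close> by the geometric mean
  \<open>\<gamma>\<close> of these; the normalized additive form then implies the product
  form.\<close>

lemma prekopa_leindler_midpoint_real: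
  fixes f g h :: "real \<Rightarrow> ennreal"
  assumes [measurable]: "f \<in> borel_measurable borel" "g \<in> borel_measurable borel" "h \<in> borel_measurable borel"
    and f: "\<And>x. f x \<le> ennreal M" "\<And>x. R < \<bar>x\<bar> \<Longrightarrow> f x = 0"
    and g: "\<And>x. g x \<le> ennreal M" "\<And>x. R < \<bar>x\<bar> \<Longrightarrow> g x = 0"
    and h: "\<And>x y. f x * g y \<le> (h ((x + y) / 2))\<^sup>2"
  shows "(\<integral>\<^sup>+x. f x \<partial>lborel) * (\<integral>\<^sup>+x. g x \<partial>lborel) \<le> (\<integral>\<^sup>+x. h x \<partial>lborel)\<^sup>2"
proof (cases "(SUP x. f x) = 0 \<or> (SUP x. g x) = 0")
  case True
  then have "(\<forall>x. f x = 0) \<or> (\<forall>x. g x = 0)"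
    by (metis SUP_upper UNIV_I le_zero_eq)
  then show ?thesis by auto
next
  case False
  have fin: "(SUP x. f x) \<le> ennreal M" "(SUP x. g x) \<le> ennreal M"
    using f g by (auto intro: SUP_least)
  obtain \<alpha> where \<alpha>: "(SUP x. f x) = ennreal \<alpha>" "\<alpha> > 0"
    using False fin(1) by (cases "SUP x. f x") (auto simp: top_unique order_less_le)
  obtain \<beta> where \<beta>: "(SUP x. g x) = ennreal \<beta>" "\<beta> > 0"
    using False fin(2) by (cases "SUP x. g x") (auto simp: top_unique order_less_le)
  define \<gamma> where "\<gamma> = sqrt (\<alpha> * \<beta>)"
  have \<gamma>: "\<gamma> > 0" "\<gamma>\<^sup>2 = \<alpha> * \<beta>" using \<alpha> \<beta> by (auto simp: \<gamma>_def)
  have f\<alpha>: "f x \<le> ennreal \<alpha>" and g\<beta>: "g x \<le> ennreal \<beta>" for x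
    unfolding \<alpha>(1)[symmetric] \<beta>(1)[symmetric] by (auto intro: SUP_upper)
  define f' where "f' x = enn2real (f x) / \<alpha>" for x
  define g' where "g' x = enn2real (g x) / \<beta>" for x
  \<comment> \<open>\<open>h\<close> may be infinite. Cutting it at \<open>\<gamma>\<close> makes it
    real and keeps the hypothesis, since \<open>f x * g y\<close> never exceeds
    \<open>\<alpha> * \<beta>\<close>, the square of \<open>\<gamma>\<close>.\<close>
  define h' where "h' x = enn2real (min (h x) (ennreal \<gamma>)) / \<gamma>" for x
  have ff: "f x = ennreal \<alpha> * ennreal (f' x)" and gg: "g x = ennreal \<beta> * ennreal (g' x)" for x
    using f\<alpha>[of x] g\<beta>[of x] \<alpha>(2) \<beta>(2)
    by (cases "f x"; cases "g x"; auto simp: f'_def g'_def top_unique simp flip: ennreal_mult)+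
  have hh: "min (h x) (ennreal \<gamma>) = ennreal \<gamma> * ennreal (h' x)" for x
  proof -
    have "min (h x) (ennreal \<gamma>) \<le> ennreal \<gamma>" by simp
    then show ?thesis
      using \<gamma>(1) by (cases "min (h x) (ennreal \<gamma>)") (auto simp: h'_def top_unique simp flip: ennreal_mult)
  qed
  have [measurable]: "f' \<in> borel_measurable borel" "g' \<in> borel_measurable borel" "h' \<in> borel_measurable borel"
    unfolding f'_def g'_def h'_def by measurable
  have "(\<integral>\<^sup>+x. f' x \<partial>lborel) + (\<integral>\<^sup>+x. g' x \<partial>lborel) \<le> 2 * (\<integral>\<^sup>+x. h' x \<partial>lborel)"
  proof (rule prekopa_leindler_midpoint_normalized[where R = R])
    show "0 \<le> f' x" "0 \<le> g' x" "0 \<le> h' x" for x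
      using \<alpha> \<beta> \<gamma> by (auto simp: f'_def g'_def h'_def)
    show "f' x \<le> 1" "g' x \<le> 1" for x
      using enn2real_mono[OF f\<alpha>[of x]] enn2real_mono[OF g\<beta>[of x]] \<alpha> \<beta> by (auto simp: f'_def g'_def)
    show "f' x = 0" "g' x = 0" if "R < \<bar>x\<bar>" for x
      using f(2) g(2) that by (auto simp: f'_def g'_def)
    show "\<exists>x. t < f' x" if "t < 1" for t
    proof (cases "t < 0")
      case True
      then show ?thesis using \<alpha> by (intro exI[of _ 0]) (auto simp: f'_def intro: less_le_trans)
    next
      case False
      then have "ennreal (t * \<alpha>) < (SUP x. f x)"
        using that \<alpha> by (simp add: ennreal_less_iff)
      then obtain x where "ennreal (t * \<alpha>) < f x" by (auto simp: less_SUP_iff)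
      then have "t * \<alpha> < \<alpha> * f' x"
        using \<alpha>(2) False by (subst (asm) ff) (simp add: ennreal_less_iff flip: ennreal_mult')
      then show ?thesis using \<alpha>(2) by (auto simp: mult.commute)
    qed
    show "\<exists>x. t < g' x" if "t < 1" for t
    proof (cases "t < 0")
      case True
      then show ?thesis using \<beta> by (intro exI[of _ 0]) (auto simp: g'_def intro: less_le_trans)
    next
      case False
      then have "ennreal (t * \<beta>) < (SUP x. g x)"
        using that \<beta> by (simp add: ennreal_less_iff)
      then obtain x where "ennreal (t * \<beta>) < g x" by (auto simp: less_SUP_iff)
      then have "t * \<beta> < \<beta> * g' x"
        using \<beta>(2) False by (subst (asm) gg) (simp add: ennreal_less_iff flip: ennreal_mult')
      then show ?thesis using \<beta>(2) by (auto simp: mult.commute)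
    qed
    fix x y
    have nn: "0 \<le> f' x" "0 \<le> g' y" "0 \<le> h' ((x + y) / 2)"
      using \<alpha> \<beta> \<gamma> by (auto simp: f'_def g'_def h'_def)
    have "f x * g y \<le> ennreal \<alpha> * ennreal \<beta>" by (intro mult_mono f\<alpha> g\<beta>) auto
    also have "\<dots> = (ennreal \<gamma>)\<^sup>2"
      using \<alpha> \<beta> \<gamma> by (simp add: ennreal_power flip: ennreal_mult)
    finally have "f x * g y \<le> (min (h ((x + y) / 2)) (ennreal \<gamma>))\<^sup>2"
      using h[of x y] by (auto simp: min_def)
    then have "ennreal (\<alpha> * \<beta> * (f' x * g' y)) \<le> ennreal (\<gamma>\<^sup>2 * (h' ((x + y) / 2))\<^sup>2)"
      unfolding hh ff[of x] gg[of y] using nn \<alpha> \<beta> \<gamma>(1)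
      by (simp add: power_mult_distrib ennreal_power ac_simps flip: ennreal_mult)
    then show "f' x * g' y \<le> (h' ((x + y) / 2))\<^sup>2"
      using \<alpha> \<beta> nn unfolding \<gamma>(2) by (subst (asm) ennreal_le_iff) auto
  qed auto
  then have le: "(\<integral>\<^sup>+x. f' x \<partial>lborel) * (\<integral>\<^sup>+x. g' x \<partial>lborel) \<le> (\<integral>\<^sup>+x. h' x \<partial>lborel)\<^sup>2"
    by (rule ennreal_mult_le_square_of_add_le)
  have "(\<integral>\<^sup>+x. f x \<partial>lborel) * (\<integral>\<^sup>+x. g x \<partial>lborel) =
      ennreal \<alpha> * ennreal \<beta> * ((\<integral>\<^sup>+x. f' x \<partial>lborel) * (\<integral>\<^sup>+x. g' x \<partial>lborel))"
    by (simp add: ff gg nn_integral_cmult ac_simps)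
  also have "\<dots> \<le> ennreal \<alpha> * ennreal \<beta> * (\<integral>\<^sup>+x. h' x \<partial>lborel)\<^sup>2"
    by (intro mult_left_mono le) auto
  also have "ennreal \<alpha> * ennreal \<beta> = (ennreal \<gamma>)\<^sup>2"
    using \<alpha> \<beta> \<gamma> by (simp add: ennreal_power flip: ennreal_mult)
  also have "(ennreal \<gamma>)\<^sup>2 * (\<integral>\<^sup>+x. h' x \<partial>lborel)\<^sup>2 = (\<integral>\<^sup>+x. min (h x) (ennreal \<gamma>) \<partial>lborel)\<^sup>2"
    by (simp add: hh nn_integral_cmult power_mult_distrib)
  also have "\<dots> \<le> (\<integral>\<^sup>+x. h x \<partial>lborel)\<^sup>2"
    by (intro power_mono nn_integral_mono) auto
  finally show ?thesis .
qed

section \<open>Prekopa--Leindler in every dimension\<close>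

definition midpt :: "nat \<Rightarrow> (nat \<Rightarrow> real) \<Rightarrow> (nat \<Rightarrow> real) \<Rightarrow> nat \<Rightarrow> real"
  where "midpt n x y = (\<lambda>i\<in>{..<n}. (x i + y i) / 2)"

interpretation lborel_product: product_sigma_finite "\<lambda>_::nat. lborel :: real measure"
  by standard

lemma nn_integral_leb_Suc:
  assumes "f \<in> borel_measurable (leb (Suc n))"
  shows "(\<integral>\<^sup>+x. f x \<partial>leb (Suc n)) = (\<integral>\<^sup>+u. (\<integral>\<^sup>+x. f (x(n := u)) \<partial>leb n) \<partial>lborel)"
  using lborel_product.product_nn_integral_insert_rev[of "{..<n}" n f] assms
  by (simp add: leb_def lessThan_Suc)

lemma sigma_finite_leb: "sigma_finite_measure (leb n)"
  unfolding leb_def by (rule lborel_product.sigma_finite) simp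

lemma measurable_fun_upd_leb:
  "(\<lambda>(u, x). x(n := u)) \<in> lborel \<Otimes>\<^sub>M leb n \<rightarrow>\<^sub>M leb (Suc n)"
  unfolding leb_def lessThan_Suc by measurable

lemma cube_eq_PiE: "{x \<in> Rn n. \<forall>i<n. \<bar>x i\<bar> \<le> R} = Pi\<^sub>E {..<n} (\<lambda>_. {-R..R})"
  by (auto simp: Rn_def PiE_def Pi_def abs_le_iff minus_le_iff)

lemma cube_sets_leb: "{x \<in> Rn n. \<forall>i<n. \<bar>x i\<bar> \<le> R} \<in> sets (leb n)"
  unfolding cube_eq_PiE leb_def by (intro sets_PiM_I_finite) auto

lemma emeasure_cube_leb:
  assumes "0 \<le> R"
  shows "emeasure (leb n) {x \<in> Rn n. \<forall>i<n. \<bar>x i\<bar> \<le> R} = ennreal ((2 * R) ^ n)"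
proof -
  have "emeasure (leb n) {x \<in> Rn n. \<forall>i<n. \<bar>x i\<bar> \<le> R} = (\<Prod>i<n. emeasure lborel {-R..R})"
    unfolding cube_eq_PiE leb_def by (rule lborel_product.emeasure_PiM) auto
  also have "emeasure lborel {-R..R} = ennreal (2 * R)"
    using assms by simp
  finally show ?thesis
    using assms by (simp add: ennreal_power)
qed

text \<open>Induction on the dimension by freezing the last coordinate. The sections at
  \<open>u\<close>, \<open>v\<close> and \<open>(u + v) / 2\<close> satisfy the hypotheses one
  dimension lower, so the section integrals satisfy those of the inequality on the line.\<close>

lemma prekopa_leindler_midpoint:
  fixes f g h :: "(nat \<Rightarrow> real) \<Rightarrow> ennreal"
  assumes "f \<in> borel_measurable (leb n)" "g \<in> borel_measurable (leb n)" "h \<in> borel_measurable (leb n)"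
    and "0 \<le> M" "0 \<le> R"
    and "\<And>x. x \<in> Rn n \<Longrightarrow> f x \<le> ennreal M" "\<And>x i. x \<in> Rn n \<Longrightarrow> i < n \<Longrightarrow> R < \<bar>x i\<bar> \<Longrightarrow> f x = 0"
    and "\<And>x. x \<in> Rn n \<Longrightarrow> g x \<le> ennreal M" "\<And>x i. x \<in> Rn n \<Longrightarrow> i < n \<Longrightarrow> R < \<bar>x i\<bar> \<Longrightarrow> g x = 0"
    and "\<And>x y. x \<in> Rn n \<Longrightarrow> y \<in> Rn n \<Longrightarrow> f x * g y \<le> (h (midpt n x y))\<^sup>2"
  shows "(\<integral>\<^sup>+x. f x \<partial>leb n) * (\<integral>\<^sup>+x. g x \<partial>leb n) \<le> (\<integral>\<^sup>+x. h x \<partial>leb n)\<^sup>2"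
  using assms
proof (induction n arbitrary: f g h)
  case 0
  \<comment> \<open>In dimension 0 the only extensional function is constantly
    \<open>undefined\<close>, and \<open>leb 0\<close> is the unit mass at it, so each integral is a
    value.\<close>
  let ?u = "\<lambda>_::nat. undefined :: real"
  have "integral\<^sup>N (leb 0) k = k ?u" for k :: "(nat \<Rightarrow> real) \<Rightarrow> ennreal"
    by (simp add: leb_def PiM_empty nn_integral_count_space_finite)
  moreover have "midpt 0 ?u ?u = ?u" by (simp add: midpt_def)
  moreover have "?u \<in> Rn 0" by (simp add: Rn_def)
  ultimately show ?case using 0(10)[of ?u ?u] by simp
next
  case (Suc n)
  note [measurable] = Suc.prems(1-3)
  interpret L: sigma_finite_measure "leb n" by (rule sigma_finite_leb)
  have upd: "x(n := u) \<in> Rn (Suc n)" if "x \<in> Rn n" for x and u :: real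
    using that by (auto simp: Rn_def lessThan_Suc)
  have sec: "(\<lambda>x. k (x(n := u))) \<in> borel_measurable (leb n)"
    if [measurable]: "k \<in> borel_measurable (leb (Suc n))" for k :: "(nat \<Rightarrow> real) \<Rightarrow> ennreal" and u
    using measurable_Pair2[OF measurable_compose[OF measurable_fun_upd_leb that], of u] by simp
  have int: "(\<lambda>u. \<integral>\<^sup>+x. k (x(n := u)) \<partial>leb n) \<in> borel_measurable borel"
    if [measurable]: "k \<in> borel_measurable (leb (Suc n))" for k :: "(nat \<Rightarrow> real) \<Rightarrow> ennreal"
    using L.borel_measurable_nn_integral_fst[OF measurable_compose[OF measurable_fun_upd_leb that]] by simp
  define F where "F u = (\<integral>\<^sup>+x. f (x(n := u)) \<partial>leb n)" for u
  define G where "G u = (\<integral>\<^sup>+x. g (x(n := u)) \<partial>leb n)" for u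
  define H where "H u = (\<integral>\<^sup>+x. h (x(n := u)) \<partial>leb n)" for u
  \<comment> \<open>Each section is at most \<open>M\<close> and vanishes outside a cube of side
    \<open>2 * R\<close>, so the boundedness required on the line is inherited.\<close>
  have bound: "(\<integral>\<^sup>+x. k (x(n := u)) \<partial>leb n) \<le> ennreal (M * (2 * R) ^ n)"
    if k: "\<And>x. x \<in> Rn (Suc n) \<Longrightarrow> k x \<le> ennreal M"
      "\<And>x i. x \<in> Rn (Suc n) \<Longrightarrow> i < Suc n \<Longrightarrow> R < \<bar>x i\<bar> \<Longrightarrow> k x = 0" for k u
  proof -
    let ?C = "{x \<in> Rn n. \<forall>i<n. \<bar>x i\<bar> \<le> R}"
    have C: "?C \<in> sets (leb n)" by (rule cube_sets_leb)
    have "(\<integral>\<^sup>+x. k (x(n := u)) \<partial>leb n) \<le> (\<integral>\<^sup>+x. ennreal M * indicator ?C x \<partial>leb n)"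
    proof (intro nn_integral_mono)
      fix x assume "x \<in> space (leb n)"
      then have x: "x \<in> Rn n" by (simp add: space_leb)
      show "k (x(n := u)) \<le> ennreal M * indicator ?C x"
      proof (cases "x \<in> ?C")
        case False
        then obtain i where "i < n" "R < \<bar>x i\<bar>" using x by auto
        then show ?thesis using k(2)[OF upd[OF x], of i u] by simp
      qed (use k(1)[OF upd[OF x], of u] in simp)
    qed
    also have "\<dots> = ennreal M * ennreal ((2 * R) ^ n)"
      by (simp only: nn_integral_cmult_indicator[OF C] emeasure_cube_leb[OF \<open>0 \<le> R\<close>])
    finally show ?thesis
      using \<open>0 \<le> M\<close> by (simp only: ennreal_mult' ac_simps)
  qed
  have supp: "(\<integral>\<^sup>+x. k (x(n := u)) \<partial>leb n) = 0"
    if k: "\<And>x i. x \<in> Rn (Suc n) \<Longrightarrow> i < Suc n \<Longrightarrow> R < \<bar>x i\<bar> \<Longrightarrow> k x = 0" and u: "R < \<bar>u\<bar>" for k u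
  proof -
    have "(\<integral>\<^sup>+x. k (x(n := u)) \<partial>leb n) = (\<integral>\<^sup>+x. 0 \<partial>leb n)"
      using k[OF upd, of _ n u] u by (intro nn_integral_cong) (simp add: space_leb)
    then show ?thesis by simp
  qed
  have "(\<integral>\<^sup>+u. F u \<partial>lborel) * (\<integral>\<^sup>+u. G u \<partial>lborel) \<le> (\<integral>\<^sup>+u. H u \<partial>lborel)\<^sup>2"
  proof (rule prekopa_leindler_midpoint_real)
    show "F \<in> borel_measurable borel" "G \<in> borel_measurable borel" "H \<in> borel_measurable borel"
      unfolding F_def G_def H_def by (intro int Suc.prems(1-3))+
    show "F u \<le> ennreal (M * (2 * R) ^ n)" "G u \<le> ennreal (M * (2 * R) ^ n)" for u
      unfolding F_def G_def by (rule bound, fact Suc.prems(6), fact Suc.prems(7))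
        (rule bound, fact Suc.prems(8), fact Suc.prems(9))
    show "F u = 0" "G u = 0" if "R < \<bar>u\<bar>" for u
      unfolding F_def G_def by (rule supp, fact Suc.prems(7), fact that)
        (rule supp, fact Suc.prems(9), fact that)
    fix u v
    show "F u * G v \<le> (H ((u + v) / 2))\<^sup>2"
      unfolding F_def G_def H_def
    proof (rule Suc.IH)
      show "(\<lambda>x. f (x(n := u))) \<in> borel_measurable (leb n)"
        "(\<lambda>x. g (x(n := v))) \<in> borel_measurable (leb n)"
        "(\<lambda>x. h (x(n := (u + v) / 2))) \<in> borel_measurable (leb n)"
        by (intro sec Suc.prems(1-3))+
      show "f (x(n := u)) \<le> ennreal M" "g (x(n := v)) \<le> ennreal M" if "x \<in> Rn n" for x
        by (rule Suc.prems(6)[OF upd[OF that]]) (rule Suc.prems(8)[OF upd[OF that]])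
      show "f (x(n := u)) = 0" if "x \<in> Rn n" "i < n" "R < \<bar>x i\<bar>" for x i
        using that by (intro Suc.prems(7)[OF upd[OF that(1)], of i]) auto
      show "g (x(n := v)) = 0" if "x \<in> Rn n" "i < n" "R < \<bar>x i\<bar>" for x i
        using that by (intro Suc.prems(9)[OF upd[OF that(1)], of i]) auto
      show "f (x(n := u)) * g (y(n := v)) \<le> (h ((midpt n x y)(n := (u + v) / 2)))\<^sup>2"
        if "x \<in> Rn n" "y \<in> Rn n" for x y
      proof -
        have "(midpt n x y)(n := (u + v) / 2) = midpt (Suc n) (x(n := u)) (y(n := v))"
          by (auto simp: midpt_def fun_eq_iff less_Suc_eq)
        then show ?thesis using Suc.prems(10)[OF upd[OF that(1)] upd[OF that(2)], of u v] by argo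
      qed
    qed (fact Suc.prems(4,5))+
  qed
  then show ?case
    using Suc.prems(1-3) by (simp add: nn_integral_leb_Suc F_def G_def H_def)
qed

section \<open>Reverse Hoelder inequality for linear functionals\<close>

text \<open>From \<open>ln (u / p) \<le> u / p - 1\<close>. It turns an exponential moment into a
  bound for the \<open>p\<close>-th moment that grows like \<open>p powr p\<close>.\<close>

lemma powr_le_exp:
  fixes u p :: real
  assumes "0 \<le> u" "0 < p"
  shows "u powr p \<le> p powr p * exp u"
proof (cases "u = 0")
  case False
  then have u: "u > 0" using assms by simp
  have "ln (u / p) \<le> u / p - 1" using u assms by (intro ln_le_minus_one) auto
  then have "p * ln (u / p) \<le> p * (u / p - 1)" using assms by (intro mult_left_mono) auto
  then have "p * ln u \<le> p * ln p + u" using u assms by (simp add: ln_div right_diff_distrib)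
  then have "exp (p * ln u) \<le> exp (p * ln p + u)" by simp
  then show ?thesis using u assms by (simp add: powr_def exp_add)
qed simp

text \<open>Log-concavity makes the quotients of successive terms nonincreasing, so the first
  quotient controls all. Once a term vanishes there is no quotient, but monotonicity makes the later
  terms vanish too.\<close>

lemma log_concave_sequence_decay:
  fixes T :: "nat \<Rightarrow> real"
  assumes "\<And>k. 0 \<le> T k" "\<And>k. T (Suc k) \<le> T k" "\<And>k. T k * T (Suc (Suc k)) \<le> (T (Suc k))\<^sup>2"
    and "T 1 \<le> r * T 0" "0 \<le> r"
  shows "T k \<le> r ^ k * T 0"
proof -
  have step: "T (Suc k) \<le> r * T k" for k
  proof (induction k)
    case (Suc k)
    show ?case
    proof (cases "T k = 0")
      case True
      then have "T (Suc k) = 0" "T (Suc (Suc k)) = 0"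
        using assms(1)[of "Suc k"] assms(2)[of k] assms(1)[of "Suc (Suc k)"] assms(2)[of "Suc k"] by linarith+
      then show ?thesis by simp
    next
      case False
      then have pos: "T k > 0" using assms(1)[of k] by linarith
      have "T k * T (Suc (Suc k)) \<le> T (Suc k) * T (Suc k)"
        using assms(3)[of k] by (simp add: power2_eq_square)
      also have "\<dots> \<le> T k * (r * T (Suc k))"
        using mult_right_mono[OF Suc.IH assms(1)[of "Suc k"]] by (simp add: ac_simps)
      finally show ?thesis using pos by simp
    qed
  qed (use assms(4) in simp)
  show ?thesis
  proof (induction k)
    case (Suc k)
    have "T (Suc k) \<le> r * T k" by (rule step)
    also have "\<dots> \<le> r * (r ^ k * T 0)" using Suc assms(5) by (intro mult_left_mono)
    finally show ?case by (simp add: ac_simps)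
  qed simp
qed

lemma vinner_vscale: "vinner n x (vscale n c z) = c * vinner n x z"
  by (simp add: vinner_def vscale_def sum_distrib_left ac_simps)

section \<open>Integration over a convex body of volume one\<close>

locale volume_one_body =
  fixes n :: nat and K :: "(nat \<Rightarrow> real) set"
  assumes body: "convex_body n K" and volume: "measure (leb n) K = 1"
begin

text \<open>A probability measure in which set integrals over \<open>K\<close> become plain
  integrals, and in which measurable functions bounded on \<open>K\<close> are integrable.\<close>

definition unif :: "(nat \<Rightarrow> real) measure"
  where "unif = restrict_space (leb n) K"

lemma K_sets [measurable]: "K \<in> sets (leb n)"
  using body by (simp add: convex_body_def compactin_sets_leb)

lemma K_subset: "K \<subseteq> Rn n"
  using sets.sets_into_space[OF K_sets] by (simp add: space_leb)

lemma emeasure_K: "emeasure (leb n) K = 1"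
  using volume by (metis emeasure_eq_ennreal_measure ennreal_1 measure_def enn2real_top zero_neq_one)

lemma space_unif: "space unif = K"
  using K_subset by (auto simp: unif_def space_restrict_space space_leb)

sublocale finite_measure unif
  by (rule finite_measureI) (simp add: space_unif unif_def emeasure_restrict_space emeasure_K)

lemma measure_space_unif: "measure unif K = 1"
  by (simp add: unif_def measure_restrict_space volume)

lemma measurable_unif: "f \<in> borel_measurable (leb n) \<Longrightarrow> f \<in> borel_measurable unif"
  unfolding unif_def by (rule measurable_restrict_space1)

lemma vinner_measurable_unif [measurable]: "(\<lambda>x. vinner n x y) \<in> borel_measurable unif"
  by (intro measurable_unif vinner_measurable)

lemma set_integral_eq: "(LINT x:K|leb n. f x) = (\<integral>x. f x \<partial>unif)" for f :: "_ \<Rightarrow> real"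
  by (simp add: unif_def set_lebesgue_integral_def integral_restrict_space)

lemma integrable_unif:
  fixes f :: "_ \<Rightarrow> real"
  assumes "f \<in> borel_measurable unif" "\<And>x. x \<in> K \<Longrightarrow> \<bar>f x\<bar> \<le> B"
  shows "integrable unif f"
  using assms by (intro integrable_const_bound[where B = B]) (auto simp: space_unif)

lemma centroid_fun_eq: "centroid_fun n q K y = (\<integral>x. \<bar>vinner n x y\<bar> powr q \<partial>unif) powr (1 / q)"
  by (simp add: centroid_fun_def set_integral_eq)

lemma centroid_fun_powr_eq:
  "q \<ge> 1 \<Longrightarrow> (\<integral>x. \<bar>vinner n x y\<bar> powr q \<partial>unif) = centroid_fun n q K y powr q"
  by (simp add: centroid_fun_powr set_integral_eq)

lemma integrable_vinner_powr_unif: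
  assumes "q \<ge> 0"
  shows "integrable unif (\<lambda>x. \<bar>vinner n x y\<bar> powr q)"
proof -
  obtain B where "\<forall>x\<in>K. \<bar>vinner n x y\<bar> \<le> B" using vinner_bounded[OF body] by blast
  then show ?thesis
    using assms by (intro integrable_unif[where B = "B powr q"]) (auto intro!: powr_mono2)
qed

lemma centroid_fun_vscale_minus: "centroid_fun n q K (vscale n (-1) y) = centroid_fun n q K y"
  by (simp add: centroid_fun_def vinner_vscale)

lemma midpt_mem:
  assumes "x \<in> K" "y \<in> K"
  shows "midpt n x y \<in> K"
proof -
  have "vadd n (vscale n (1/2) x) (vscale n (1/2) y) \<in> K"
    using body assms unfolding convex_body_def by simp
  also have "vadd n (vscale n (1/2) x) (vscale n (1/2) y) = midpt n x y"
    by (auto simp: vadd_def vscale_def midpt_def fun_eq_iff add_divide_distrib)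
  finally show ?thesis .
qed

lemma K_in_cube:
  obtains R where "0 \<le> R" "\<And>x i. x \<in> K \<Longrightarrow> i < n \<Longrightarrow> \<bar>x i\<bar> \<le> R"
proof -
  have "\<forall>i\<in>{..<n}. \<exists>B. \<forall>x\<in>K. \<bar>x i\<bar> \<le> B"
    using body compactin_bounded by (auto simp: convex_body_def)
  then obtain b where b: "\<And>i x. i < n \<Longrightarrow> x \<in> K \<Longrightarrow> \<bar>x i\<bar> \<le> b i"
    by (metis lessThan_iff)
  have "\<bar>x i\<bar> \<le> (\<Sum>i<n. \<bar>b i\<bar>)" if "x \<in> K" "i < n" for x i
  proof -
    have "\<bar>x i\<bar> \<le> \<bar>b i\<bar>" using b[OF that(2,1)] by linarith
    also have "\<dots> \<le> (\<Sum>i<n. \<bar>b i\<bar>)" using that by (intro member_le_sum) auto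
    finally show ?thesis .
  qed
  then show ?thesis by (intro that[of "\<Sum>i<n. \<bar>b i\<bar>"]) (auto intro: sum_nonneg)
qed

section \<open>Tails and moments of linear functionals on the body\<close>

definition tail :: "(nat \<Rightarrow> real) \<Rightarrow> real \<Rightarrow> real"
  where "tail z s = measure unif {x \<in> K. s < vinner n x z}"

lemma vinner_superlevel_sets [measurable]: "{x \<in> K. s < vinner n x z} \<in> sets unif"
  using borel_measurable_less[OF borel_measurable_const vinner_measurable_unif, of s z]
  by (simp only: space_unif)

lemma abs_vinner_superlevel_sets [measurable]: "{x \<in> K. s \<le> \<bar>vinner n x z\<bar>} \<in> sets unif"
  using borel_measurable_le[OF borel_measurable_const borel_measurable_abs[OF vinner_measurable_unif], of s z]
  by (simp only: space_unif)

lemma tail_antimono: "s \<le> t \<Longrightarrow> tail z t \<le> tail z s"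
  unfolding tail_def by (intro finite_measure_mono) auto

text \<open>Prekopa--Leindler for the indicators of the parts of \<open>K\<close> cut off by
  half-spaces: by convexity, midpoints of points in the parts at levels \<open>s\<close> and
  \<open>t\<close> lie in the part at level \<open>(s + t) / 2\<close>.\<close>

lemma tail_midpoint_log_concave: "tail z s * tail z t \<le> (tail z ((s + t) / 2))\<^sup>2"
proof -
  let ?S = "\<lambda>s. {x \<in> K. s < vinner n x z}"
  have em: "emeasure (leb n) (?S s) = ennreal (tail z s)" for s
    unfolding tail_def emeasure_eq_measure[symmetric]
    by (simp add: unif_def emeasure_restrict_space)
  have S: "?S s \<in> sets (leb n)" for s
    using vinner_superlevel_sets[of s z] by (auto simp: unif_def sets_restrict_space_iff)
  obtain R where R: "0 \<le> R" "\<And>x i. x \<in> K \<Longrightarrow> i < n \<Longrightarrow> \<bar>x i\<bar> \<le> R"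
    using K_in_cube by blast
  have "(\<integral>\<^sup>+x. indicator (?S s) x \<partial>leb n) * (\<integral>\<^sup>+x. indicator (?S t) x \<partial>leb n)
      \<le> (\<integral>\<^sup>+x. indicator (?S ((s + t) / 2)) x \<partial>leb n)\<^sup>2"
  proof (rule prekopa_leindler_midpoint[where M = 1 and R = R])
    have supp: "indicator (?S r) x = (0 :: ennreal)" if "i < n" "R < \<bar>x i\<bar>" for r x i
      using R(2)[OF _ that(1), of x] that(2) by (auto simp: indicator_def)
    show "indicator (?S s) x = (0 :: ennreal)" "indicator (?S t) x = (0 :: ennreal)"
      if "i < n" "R < \<bar>x i\<bar>" for x i
      using supp[of _ x] that by blast+
    show "indicator (?S s) \<in> borel_measurable (leb n)" "indicator (?S t) \<in> borel_measurable (leb n)"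
      "indicator (?S ((s + t) / 2)) \<in> borel_measurable (leb n)"
      by (intro borel_measurable_indicator S)+
    show "indicator (?S s) x * indicator (?S t) y \<le> (indicator (?S ((s + t) / 2)) (midpt n x y) :: ennreal)\<^sup>2" for x y
    proof (cases "x \<in> ?S s \<and> y \<in> ?S t")
      case True
      have "vinner n (midpt n x y) z = (vinner n x z + vinner n y z) / 2"
        by (simp add: vinner_def midpt_def sum.distrib[symmetric] sum_divide_distrib algebra_simps add_divide_distrib)
      then have "midpt n x y \<in> ?S ((s + t) / 2)"
        using True midpt_mem by auto
      then show ?thesis by (auto simp: indicator_def)
    qed (auto simp: indicator_def)
  qed (use R(1) in \<open>auto split: split_indicator\<close>)
  then have "ennreal (tail z s) * ennreal (tail z t) \<le> (ennreal (tail z ((s + t) / 2)))\<^sup>2"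
    by (simp only: nn_integral_indicator[OF S] em)
  then show ?thesis
    by (simp add: tail_def ennreal_power flip: ennreal_mult)
qed

lemma vinner_markov:
  assumes q: "q \<ge> 1" and pos: "centroid_fun n q K z > 0" and c: "c > 0"
  shows "measure unif {x \<in> K. c * centroid_fun n q K z \<le> \<bar>vinner n x z\<bar>} \<le> c powr (- q)"
proof -
  let ?a = "centroid_fun n q K z"
  let ?S = "{x \<in> K. c * ?a \<le> \<bar>vinner n x z\<bar>}"
  have S: "?S \<in> sets unif" by measurable
  have "measure unif ?S = (\<integral>x. indicator ?S x \<partial>unif)"
    using S by simp
  also have "\<dots> \<le> (\<integral>x. \<bar>vinner n x z\<bar> powr q / (c * ?a) powr q \<partial>unif)"
  proof (intro integral_mono)
    show "integrable unif (indicator ?S :: _ \<Rightarrow> real)"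
      using S by (auto simp: emeasure_eq_measure)
    show "integrable unif (\<lambda>x. \<bar>vinner n x z\<bar> powr q / (c * ?a) powr q)"
      using q integrable_vinner_powr_unif by auto
    fix x
    show "indicator ?S x \<le> \<bar>vinner n x z\<bar> powr q / (c * ?a) powr q"
      using q pos c powr_mono2[of q "c * ?a" "\<bar>vinner n x z\<bar>"] by (auto simp: indicator_def)
  qed
  also have "\<dots> = ?a powr q / (c * ?a) powr q"
    by (simp add: centroid_fun_powr_eq[OF q])
  also have "\<dots> = c powr (- q)"
    using pos c by (simp add: powr_mult powr_minus_divide)
  finally show ?thesis .
qed

text \<open>
  The levels form an arithmetic progression through \<open>- b\<close> and \<open>b\<close>, where \<open>b\<close> is three times the
  value of \<open>centroid_fun\<close>. By Markov's inequality the first quotient of tails is at most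
  \<open>exp (- q)\<close>, and by log-concavity the later quotients are no larger. Starting at \<open>- b\<close> rather than \<open>0\<close>
  avoids a lower bound for the measure of a half of \<open>K\<close>.
\<close>

lemma tail_decay:
  assumes q: "q \<ge> 2" and pos: "centroid_fun n q K z > 0"
  shows "tail z (3 * centroid_fun n q K z * (2 * real k - 1)) \<le> exp (- q) ^ k"
proof -
  define b where "b = 3 * centroid_fun n q K z"
  define T where "T k = tail z (b * (2 * real k - 1))" for k
  have b: "b > 0" using pos by (simp add: b_def)
  let ?S = "{x \<in> K. b \<le> \<bar>vinner n x z\<bar>}"
  have S: "?S \<in> sets unif" by measurable
  have mS: "measure unif ?S \<le> 3 powr (- q)"
    using vinner_markov[of q z 3] q pos by (simp add: b_def)
  have T1: "T 1 \<le> 3 powr (- q)"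
    unfolding T_def tail_def by (rule order_trans[OF finite_measure_mono mS]) (use S in auto)
  have "1 = measure unif K" by (simp add: measure_space_unif)
  also have "\<dots> \<le> measure unif ({x \<in> K. - b < vinner n x z} \<union> ?S)"
    using S by (intro finite_measure_mono) auto
  also have "\<dots> \<le> T 0 + measure unif ?S"
    using S unfolding T_def tail_def by (intro order_trans[OF measure_Un_le]) auto
  finally have T0: "T 0 \<ge> 1 - 3 powr (- q)" using mS by linarith
  have "3 powr (- q) \<le> 3 powr (-2 :: real)" using q by (intro powr_mono) auto
  then have q9: "3 powr (- q) \<le> 1/9" by (simp add: powr_minus_divide)
  have T0': "T 0 \<le> 1"
    using finite_measure_mono[of "{x \<in> K. - b < vinner n x z}" K] measure_space_unif sets.top[of unif]
    by (simp add: T_def tail_def space_unif)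
  \<comment> \<open>Since \<open>T 0\<close> is at least 8/9, the first quotient is at most
    \<open>9/8 * 3 powr (- q)\<close>. This is below \<open>exp (- q)\<close> because
    \<open>(3 / exp 1) powr q\<close> is at least 9/8 already for \<open>q = 2\<close>; hence the
    factor 3 in \<open>b\<close>.\<close>
  have "(9/8 :: real) \<le> (3 / exp 1) powr 2"
  proof -
    have "(exp 1)\<^sup>2 \<le> (272/100 :: real)\<^sup>2" using e_less_272 by (intro power_mono) auto
    then have "9/8 * (exp 1)\<^sup>2 \<le> (9 :: real)" by (simp add: power2_eq_square)
    then show ?thesis by (simp add: power_divide field_simps)
  qed
  also have "\<dots> \<le> (3 / exp 1) powr q"
    using q e_less_272 by (intro powr_mono) auto
  also have "\<dots> = 3 powr q * exp (- q)"
    by (subst powr_divide) (auto simp: powr_def exp_minus divide_inverse)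
  finally have "9/8 * 3 powr (- q) \<le> exp (- q)"
    by (simp add: powr_minus field_simps)
  then have "3 powr (- q) \<le> exp (- q) * (8/9)" by simp
  also have "\<dots> \<le> exp (- q) * T 0" using T0 q9 by (intro mult_left_mono) auto
  finally have "T 1 \<le> exp (- q) * T 0" using T1 by linarith
  then have "T k \<le> exp (- q) ^ k * T 0"
  proof (rule log_concave_sequence_decay[rotated 3])
    show "T (Suc k) \<le> T k" for k unfolding T_def using b by (intro tail_antimono) (simp add: algebra_simps)
    show "T k * T (Suc (Suc k)) \<le> (T (Suc k))\<^sup>2" for k
    proof -
      have "(b * (2 * real k - 1) + b * (2 * real (Suc (Suc k)) - 1)) / 2 = b * (2 * real (Suc k) - 1)"
        by (simp add: algebra_simps)
      then show ?thesis
        using tail_midpoint_log_concave[of z "b * (2 * real k - 1)" "b * (2 * real (Suc (Suc k)) - 1)"]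
        by (simp only: T_def)
    qed
  qed (auto simp: T_def tail_def)
  also have "\<dots> \<le> exp (- q) ^ k" using T0' by (simp add: mult_left_le)
  finally show ?thesis by (simp add: T_def b_def)
qed

text \<open>The lower tail in direction \<open>z\<close> is the upper tail in the opposite
  direction, where \<open>centroid_fun\<close> has the same value.\<close>

lemma measure_abs_vinner_le:
  assumes q: "q \<ge> 2" and pos: "centroid_fun n q K z > 0"
  shows "measure unif {x \<in> K. 3 * centroid_fun n q K z * (2 * real k - 1) < \<bar>vinner n x z\<bar>} \<le> 2 * exp (- q) ^ k"
proof -
  let ?s = "3 * centroid_fun n q K z * (2 * real k - 1)"
  let ?z = "vscale n (-1) z"
  have "measure unif {x \<in> K. ?s < \<bar>vinner n x z\<bar>} \<le>
      measure unif ({x \<in> K. ?s < vinner n x z} \<union> {x \<in> K. ?s < vinner n x ?z})"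
    by (intro finite_measure_mono sets.Un vinner_superlevel_sets) (auto simp: vinner_vscale abs_real_def)
  also have "\<dots> \<le> tail z ?s + tail ?z ?s"
    unfolding tail_def by (intro measure_Un_le) auto
  also have "\<dots> \<le> exp (- q) ^ k + exp (- q) ^ k"
    using tail_decay[OF q pos, of k] tail_decay[OF q, of ?z k] pos
    by (intro add_mono) (auto simp: centroid_fun_vscale_minus)
  finally show ?thesis by simp
qed

end

lemma sum_half_powers_le: "(\<Sum>k\<le>m. (1/2 :: real) ^ k) \<le> 2"
proof -
  have "(\<Sum>k\<le>m. (1/2 :: real) ^ k) = 2 - (1/2) ^ m"
    by (induction m) auto
  then show ?thesis by simp
qed

context volume_one_body
begin

text \<open>Sum over shells of width \<open>2 * b\<close>. On shell \<open>k\<close> the integrand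
  is at most \<open>exp (q * (2 * k + 1) / 4)\<close> and the measure at most
  \<open>2 * exp (- q) ^ k\<close>. The products are dominated by a geometric series of ratio
  \<open>exp (- (q / 2))\<close>, which is below 1/2.\<close>

lemma exponential_moment:
  assumes q: "q \<ge> 2" and pos: "centroid_fun n q K z > 0"
  shows "(\<integral>x. exp (q * \<bar>vinner n x z\<bar> / (12 * centroid_fun n q K z)) \<partial>unif) \<le> 4 * exp (q / 4)"
proof -
  define b where "b = 3 * centroid_fun n q K z"
  define E where "E k = {x \<in> K. b * (2 * real k - 1) < \<bar>vinner n x z\<bar>}" for k
  have b: "b > 0" using pos by (simp add: b_def)
  have E [measurable]: "E k \<in> sets unif" for k
    using borel_measurable_less[OF borel_measurable_const borel_measurable_abs[OF vinner_measurable_unif],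
        of "b * (2 * real k - 1)" z]
    by (simp only: space_unif E_def)
  obtain B where B: "\<forall>x\<in>K. \<bar>vinner n x z\<bar> \<le> B" using vinner_bounded[OF body] by blast
  \<comment> \<open>\<open>K\<close> is bounded, so finitely many shells suffice and the sum stays
    finite.\<close>
  obtain m :: nat where "B / b \<le> real m" using real_arch_simple by blast
  then have "B \<le> real m * b" using b by (simp add: field_simps)
  also have "\<dots> \<le> b * (2 * real m + 1)" using b by (simp add: algebra_simps)
  finally have m: "B \<le> b * (2 * real m + 1)" .
  let ?c = "\<lambda>k. exp (q * (2 * real k + 1) / 4)"
  have pw: "exp (q * \<bar>vinner n x z\<bar> / (4 * b)) \<le> (\<Sum>k\<le>m. ?c k * indicator (E k) x)" if x: "x \<in> K" for x
  proof -
    let ?P = "\<lambda>k. \<bar>vinner n x z\<bar> \<le> b * (2 * real k + 1)"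
    define k where "k = (LEAST k. ?P k)"
    have Pm: "?P m" using B x m by force
    have k: "?P k" "k \<le> m" unfolding k_def using LeastI[of ?P, OF Pm] Least_le[of ?P, OF Pm] by auto
    \<comment> \<open>\<open>E 0\<close> is all of \<open>K\<close> because its level is negative.
      For \<open>k = Suc j\<close>, minimality of \<open>k\<close> says that \<open>x\<close> lies
      beyond the outer level of shell \<open>j\<close>, which is the inner level of shell
      \<open>k\<close>.\<close>
    have "x \<in> E k"
    proof (cases k)
      case 0
      then show ?thesis using x b by (simp add: E_def)
    next
      case (Suc j)
      then have "\<not> ?P j" unfolding k_def using not_less_Least[of j ?P] by linarith
      then show ?thesis using x Suc by (simp add: E_def algebra_simps)
    qed
    have "q * \<bar>vinner n x z\<bar> / (4 * b) \<le> q * (b * (2 * real k + 1)) / (4 * b)"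
      using k(1) q b by (intro divide_right_mono mult_left_mono) auto
    also have "\<dots> = q * (2 * real k + 1) / 4" using b by simp
    finally have "exp (q * \<bar>vinner n x z\<bar> / (4 * b)) \<le> ?c k * indicator (E k) x"
      using \<open>x \<in> E k\<close> by simp
    also have "\<dots> \<le> (\<Sum>k\<le>m. ?c k * indicator (E k) x)"
      using k(2) by (intro member_le_sum[where f = "\<lambda>k. ?c k * indicator (E k) x"]) auto
    finally show ?thesis .
  qed
  have "(\<integral>x. exp (q * \<bar>vinner n x z\<bar> / (4 * b)) \<partial>unif) \<le> (\<integral>x. (\<Sum>k\<le>m. ?c k * indicator (E k) x) \<partial>unif)"
  proof (intro integral_mono)
    show "integrable unif (\<lambda>x. exp (q * \<bar>vinner n x z\<bar> / (4 * b)))"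
    proof (rule integrable_unif[where B = "exp (q * B / (4 * b))"])
      show "(\<lambda>x. exp (q * \<bar>vinner n x z\<bar> / (4 * b))) \<in> borel_measurable unif" by measurable
      show "\<bar>exp (q * \<bar>vinner n x z\<bar> / (4 * b))\<bar> \<le> exp (q * B / (4 * b))" if "x \<in> K" for x
        using B that q b by (auto intro!: divide_right_mono mult_left_mono)
    qed
    show "integrable unif (\<lambda>x. \<Sum>k\<le>m. ?c k * indicator (E k) x)"
      by (intro Bochner_Integration.integrable_sum integrable_mult_right integrable_real_indicator E)
        (simp add: emeasure_eq_measure)
  qed (use pw in \<open>auto simp: space_unif\<close>)
  also have "\<dots> = (\<Sum>k\<le>m. ?c k * measure unif (E k))"
    by (subst Bochner_Integration.integral_sum) (auto simp: emeasure_eq_measure)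
  also have "\<dots> \<le> (\<Sum>k\<le>m. 2 * exp (q / 4) * (1/2) ^ k)"
  proof (intro sum_mono)
    fix k
    have "?c k * measure unif (E k) \<le> ?c k * (2 * exp (- q) ^ k)"
      using measure_abs_vinner_le[OF q pos, of k] by (intro mult_left_mono) (auto simp: E_def b_def)
    also have "\<dots> = 2 * exp (q / 4) * exp (- (q / 2)) ^ k"
      by (simp add: algebra_simps add_divide_distrib flip: exp_of_nat_mult exp_add)
    also have "\<dots> \<le> 2 * exp (q / 4) * (1/2) ^ k"
    proof (intro mult_left_mono power_mono)
      have "exp (- (q / 2)) \<le> exp (- 1 :: real)" using q by simp
      also have "\<dots> \<le> 1/2" using exp_ge_add_one_self[of 1] by (simp add: exp_minus field_simps)
      finally show "exp (- (q / 2)) \<le> 1/2" .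
    qed auto
    finally show "?c k * measure unif (E k) \<le> 2 * exp (q / 4) * (1/2) ^ k" .
  qed
  also have "\<dots> \<le> 2 * exp (q / 4) * 2"
    unfolding sum_distrib_left[symmetric] by (intro mult_left_mono sum_half_powers_le) auto
  finally show ?thesis by (simp add: b_def)
qed

text \<open>For the degenerate case, in which one cannot divide by
  \<open>centroid_fun n q K z\<close>.\<close>

lemma AE_vinner_eq_0:
  assumes "q \<ge> 1" "centroid_fun n q K z = 0"
  shows "AE x in unif. vinner n x z = 0"
proof -
  have "(\<integral>x. \<bar>vinner n x z\<bar> powr q \<partial>unif) = 0"
    using centroid_fun_powr_eq[OF assms(1), of z] assms(2) by simp
  then have "AE x in unif. \<bar>vinner n x z\<bar> powr q = 0"
    using integrable_vinner_powr_unif[of q z] assms(1)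
    by (subst (asm) integral_nonneg_eq_0_iff_AE) auto
  then show ?thesis by eventually_elim simp
qed

text \<open>Bound the \<open>p\<close>-th power pointwise by an exponential, integrate with
  \<open>exponential_moment\<close> and take \<open>p\<close>-th roots. The constant is
  \<open>12 * 2 * 3\<close>, with 3 in place of \<open>exp 1\<close>.\<close>

lemma centroid_fun_reverse_holder:
  assumes q: "2 \<le> q" "q \<le> p"
  shows "centroid_fun n p K z \<le> 72 * (p / q) * centroid_fun n q K z"
proof (cases "centroid_fun n q K z = 0")
  case True
  have "AE x in unif. vinner n x z = 0" using AE_vinner_eq_0[OF _ True] q by simp
  then have "AE x in unif. \<bar>vinner n x z\<bar> powr p = 0" by eventually_elim simp
  then have "(\<integral>x. \<bar>vinner n x z\<bar> powr p \<partial>unif) = 0"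
    by (rule integral_eq_zero_AE)
  then show ?thesis using True by (simp add: centroid_fun_eq)
next
  case False
  let ?a = "centroid_fun n q K z"
  have pos: "?a > 0" using False centroid_fun_nonneg[of n q K z] by linarith
  have p: "p \<ge> 2" using q by linarith
  \<comment> \<open>Chosen so that \<open>c / p\<close> times the exponent in
    \<open>exponential_moment\<close> is the absolute value of the functional.\<close>
  define c where "c = 12 * ?a * p / q"
  have c: "c > 0" using pos p q by (simp add: c_def)
  have pw: "\<bar>vinner n x z\<bar> powr p \<le> c powr p * exp (q * \<bar>vinner n x z\<bar> / (12 * ?a))" for x
  proof -
    let ?u = "q * \<bar>vinner n x z\<bar> / (12 * ?a)"
    have u: "?u \<ge> 0" using q pos by simp
    have eq: "(c / p) * ?u = \<bar>vinner n x z\<bar>" using q p pos by (simp add: c_def)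
    have "((c / p) * ?u) powr p = (c / p) powr p * ?u powr p"
      by (rule powr_mult)
    then have "\<bar>vinner n x z\<bar> powr p = (c / p) powr p * ?u powr p"
      by (simp only: eq)
    also have "\<dots> \<le> (c / p) powr p * (p powr p * exp ?u)"
      using p u by (intro mult_left_mono powr_le_exp) auto
    also have "\<dots> = c powr p * exp ?u"
      using p c by (simp add: powr_divide)
    finally show ?thesis .
  qed
  obtain B where B: "\<forall>x\<in>K. \<bar>vinner n x z\<bar> \<le> B" using vinner_bounded[OF body] by blast
  have int: "integrable unif (\<lambda>x. exp (q * \<bar>vinner n x z\<bar> / (12 * ?a)))"
  proof (rule integrable_unif[where B = "exp (q * B / (12 * ?a))"])
    show "(\<lambda>x. exp (q * \<bar>vinner n x z\<bar> / (12 * ?a))) \<in> borel_measurable unif" by measurable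
    show "\<bar>exp (q * \<bar>vinner n x z\<bar> / (12 * ?a))\<bar> \<le> exp (q * B / (12 * ?a))" if "x \<in> K" for x
      using B that q pos by (auto intro!: divide_right_mono mult_left_mono)
  qed
  have "centroid_fun n p K z powr p = (\<integral>x. \<bar>vinner n x z\<bar> powr p \<partial>unif)"
    using p by (simp add: centroid_fun_powr_eq)
  also have "\<dots> \<le> (\<integral>x. c powr p * exp (q * \<bar>vinner n x z\<bar> / (12 * ?a)) \<partial>unif)"
    using pw int p by (intro integral_mono integrable_vinner_powr_unif integrable_mult_right) auto
  also have "\<dots> \<le> c powr p * (4 * exp (q / 4))"
    using exponential_moment[OF q(1) pos] by (simp add: mult_left_mono)
  \<comment> \<open>The prefactor must become a \<open>p\<close>-th power to survive the root as a
    constant: \<open>4 \<le> 2 powr p\<close> as \<open>p \<ge> 2\<close>, and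
    \<open>q / 4 \<le> p\<close>.\<close>
  also have "\<dots> \<le> c powr p * (2 powr p * exp 1 powr p)"
  proof (intro mult_left_mono mult_mono)
    have "2 powr 2 \<le> (2 :: real) powr p" using p by (intro powr_mono) auto
    then show "4 \<le> (2 :: real) powr p" by simp
    show "exp (q / 4) \<le> exp 1 powr p" using q by (simp add: powr_def)
  qed auto
  also have "\<dots> = (c * 2 * exp 1) powr p"
    using c by (simp add: powr_mult)
  finally have "centroid_fun n p K z powr p \<le> (c * 2 * exp 1) powr p" .
  then have "\<not> c * 2 * exp 1 < centroid_fun n p K z"
    using powr_less_mono2[of p "c * 2 * exp 1" "centroid_fun n p K z"] c p by auto
  then have "centroid_fun n p K z \<le> c * 2 * exp 1" by simp
  also have "\<dots> \<le> c * 2 * 3" using e_less_272 c by (intro mult_left_mono) auto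
  finally show ?thesis by (simp add: c_def ac_simps)
qed

end

section \<open>The covering argument\<close>

definition sqnorm :: "nat \<Rightarrow> (nat \<Rightarrow> real) \<Rightarrow> real"
  where "sqnorm n x = (\<Sum>i<n. (x i)\<^sup>2)"

lemma sqnorm_nonneg: "0 \<le> sqnorm n x"
  by (simp add: sqnorm_def sum_nonneg)

text \<open>Cauchy--Schwarz; it reduces the fourth moment of the Euclidean norm to those of the
  coordinates.\<close>

lemma sqnorm_power2_le: "(sqnorm n x)\<^sup>2 \<le> n * (\<Sum>i<n. (x i) ^ 4)"
proof -
  have "(\<Sum>i<n. (x i)\<^sup>2 * 1)\<^sup>2 \<le> (\<Sum>i<n. ((x i)\<^sup>2)\<^sup>2) * (\<Sum>i<n. 1\<^sup>2)"
    by (rule Cauchy_Schwarz_ineq_sum)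
  then show ?thesis by (simp add: sqnorm_def mult.commute flip: power_mult)
qed

text \<open>Here \<open>x\<close> and \<open>z\<close> lie in one ball around \<open>c\<close>.
  Coordinatewise, with \<open>d = x i - z i\<close>, the square of \<open>x i\<close> is
  \<open>x i * z i + x i * d\<close>, the last term is at most an eighth of that square plus twice
  the square of \<open>d\<close>, and \<open>d\<close> is estimated through
  \<open>c i\<close>.\<close>

lemma sqnorm_le_vinner_of_near:
  assumes "(\<Sum>i<n. (x i - c i)\<^sup>2) \<le> r\<^sup>2" "(\<Sum>i<n. (z i - c i)\<^sup>2) \<le> r\<^sup>2"
  shows "sqnorm n x \<le> \<bar>vinner n x z\<bar> + sqnorm n x / 8 + 8 * r\<^sup>2"
proof -
  have "(x i)\<^sup>2 \<le> x i * z i + (x i)\<^sup>2 / 8 + 4 * ((x i - c i)\<^sup>2 + (z i - c i)\<^sup>2)" for i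
  proof -
    have "0 \<le> (x i - 4 * (x i - z i))\<^sup>2 / 8" "0 \<le> 2 * ((x i - c i) + (z i - c i))\<^sup>2"
      by simp_all
    then show ?thesis by (simp add: power2_eq_square algebra_simps)
  qed
  then have "sqnorm n x \<le> (\<Sum>i<n. x i * z i + (x i)\<^sup>2 / 8 + 4 * ((x i - c i)\<^sup>2 + (z i - c i)\<^sup>2))"
    unfolding sqnorm_def by (intro sum_mono)
  also have "\<dots> = vinner n x z + sqnorm n x / 8 + 4 * ((\<Sum>i<n. (x i - c i)\<^sup>2) + (\<Sum>i<n. (z i - c i)\<^sup>2))"
    by (simp add: vinner_def sqnorm_def sum.distrib sum_divide_distrib flip: sum_distrib_left)
  also have "\<dots> \<le> \<bar>vinner n x z\<bar> + sqnorm n x / 8 + 4 * (r\<^sup>2 + r\<^sup>2)"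
    using assms by (intro add_mono mult_left_mono) auto
  finally show ?thesis by simp
qed

lemma mem_ball_translate:
  assumes "x \<in> vadd n c ` vscale n r ` unit_ball n"
  shows "(\<Sum>i<n. (x i - c i)\<^sup>2) \<le> r\<^sup>2"
proof -
  obtain u where u: "u \<in> unit_ball n" "x = vadd n c (vscale n r u)" using assms by blast
  have "(\<Sum>i<n. (u i)\<^sup>2) \<le> 1"
    using u(1) by (simp add: unit_ball_def L2_set_def)
  then have "r\<^sup>2 * (\<Sum>i<n. (u i)\<^sup>2) \<le> r\<^sup>2 * 1" by (intro mult_left_mono) auto
  then show ?thesis
    by (simp add: u(2) vadd_def vscale_def power_mult_distrib sum_distrib_left)
qed

lemma mem_ball_translateI:
  assumes "r > 0" "x \<in> Rn n" "(\<Sum>i<n. (x i - c i)\<^sup>2) \<le> r\<^sup>2"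
  shows "x \<in> vadd n c ` vscale n r ` unit_ball n"
proof -
  define u where "u = (\<lambda>i\<in>{..<n}. (x i - c i) / r)"
  have "(\<Sum>i<n. (u i)\<^sup>2) = (\<Sum>i<n. (x i - c i)\<^sup>2) / r\<^sup>2"
    by (simp add: u_def power_divide sum_divide_distrib)
  also have "\<dots> \<le> 1" using assms by simp
  finally have "u \<in> unit_ball n"
    by (simp add: unit_ball_def L2_set_def u_def Rn_def)
  moreover have "x = vadd n c (vscale n r u)"
    using assms(1,2) by (auto simp: u_def vadd_def vscale_def Rn_def PiE_def extensional_def fun_eq_iff)
  ultimately show ?thesis by blast
qed

text \<open>The \<open>LEAST\<close> in \<open>covering_number\<close> is attained once some finite
  covering with centers in \<open>K\<close> exists; compactness provides one, from the cover by open
  balls around all points of \<open>K\<close>.\<close>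

lemma compactin_covering_number:
  assumes K: "compactin (powertop_real {..<n}) K" and r: "r > 0"
  obtains F where "F \<subseteq> K" "finite F" "card F = covering_number n K K (vscale n r ` unit_ball n)"
    "K \<subseteq> (\<Union>c\<in>F. vadd n c ` vscale n r ` unit_ball n)"
proof -
  define U where "U c = {x \<in> topspace (powertop_real {..<n}). (\<Sum>i<n. (x i - c i)\<^sup>2) \<in> {..<r\<^sup>2}}" for c :: "nat \<Rightarrow> real"
  have KR: "K \<subseteq> Rn n" "K \<subseteq> topspace (powertop_real {..<n})"
    using compactin_subset_topspace[OF K] by (auto simp: Rn_def)
  have "openin (powertop_real {..<n}) (U c)" for c
    unfolding U_def
  proof (rule openin_continuous_map_preimage)
    show "continuous_map (powertop_real {..<n}) euclideanreal (\<lambda>x. \<Sum>i<n. (x i - c i)\<^sup>2)"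
      by (intro continuous_map_sum continuous_map_real_pow continuous_map_diff
          continuous_map_product_projection continuous_map_canonical_const) auto
  qed simp
  moreover have "K \<subseteq> \<Union> (U ` K)"
  proof
    fix x assume x: "x \<in> K"
    then have "x \<in> U x" using KR(2) r by (auto simp: U_def)
    then show "x \<in> \<Union> (U ` K)" using x by blast
  qed
  ultimately obtain \<F> where \<F>: "finite \<F>" "\<F> \<subseteq> U ` K" "K \<subseteq> \<Union> \<F>"
    using compactinD[OF K, of "U ` K"] by blast
  then obtain F where F: "F \<subseteq> K" "finite F" "K \<subseteq> \<Union> (U ` F)"
    using finite_subset_image[OF \<F>(1,2)] by blast
  have "K \<subseteq> (\<Union>c\<in>F. vadd n c ` vscale n r ` unit_ball n)"
  proof
    fix x assume x: "x \<in> K"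
    then obtain c where c: "c \<in> F" "x \<in> U c" using F(3) by blast
    then have "x \<in> vadd n c ` vscale n r ` unit_ball n"
      using r x KR by (intro mem_ball_translateI) (auto simp: U_def)
    then show "x \<in> (\<Union>c\<in>F. vadd n c ` vscale n r ` unit_ball n)" using c by blast
  qed
  then have "\<exists>m. \<exists>F\<subseteq>K. finite F \<and> card F = m \<and> K \<subseteq> (\<Union>c\<in>F. vadd n c ` vscale n r ` unit_ball n)"
    by (intro exI[of _ "card F"] exI[of _ F] conjI F(1,2) refl)
  from LeastI_ex[OF this] show ?thesis
    unfolding covering_number_def[symmetric] by (elim exE conjE) (rule that)
qed

definition basis_vec :: "nat \<Rightarrow> nat \<Rightarrow> nat \<Rightarrow> real"
  where "basis_vec n i = (\<lambda>j\<in>{..<n}. if j = i then 1 else 0)"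

lemma vinner_basis_vec: "i < n \<Longrightarrow> vinner n x (basis_vec n i) = x i"
proof -
  assume "i < n"
  have "vinner n x (basis_vec n i) = (\<Sum>j<n. if j = i then x j else 0)"
    unfolding vinner_def by (intro sum.cong) (auto simp: basis_vec_def)
  then show ?thesis using \<open>i < n\<close> by simp
qed

lemma basis_vec_unit_sphere:
  assumes "i < n"
  shows "basis_vec n i \<in> unit_sphere n"
proof -
  have "(\<Sum>j<n. (basis_vec n i j)\<^sup>2) = (\<Sum>j<n. if j = i then 1 else 0)"
    by (intro sum.cong) (auto simp: basis_vec_def)
  then show ?thesis
    using assms by (simp add: unit_sphere_def L2_set_def Rn_def basis_vec_def)
qed

text \<open>A value above the threshold \<open>s\<close> is at most its \<open>p\<close>-th power
  over \<open>s powr (p - 1)\<close>. A maximum over \<open>Z\<close> is thus replaced by a sum that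
  can be integrated term by term.\<close>

lemma le_threshold_add_sum_powr:
  fixes f :: "'a \<Rightarrow> real"
  assumes "finite Z" "z \<in> Z" "0 < s" "1 \<le> p" "\<And>z. 0 \<le> f z"
  shows "f z \<le> s + (\<Sum>z\<in>Z. f z powr p / s powr (p - 1))"
proof (cases "f z \<le> s")
  case True
  moreover have "0 \<le> (\<Sum>z\<in>Z. f z powr p / s powr (p - 1))" by (intro sum_nonneg) auto
  ultimately show ?thesis by linarith
next
  case False
  then have pos: "0 < f z" using assms(3) by linarith
  have "s powr (p - 1) \<le> f z powr (p - 1)"
    using False assms(3,4) by (intro powr_mono2) linarith+
  then have "f z * s powr (p - 1) \<le> f z * f z powr (p - 1)"
    using pos by (intro mult_left_mono) simp_all
  also have "\<dots> = f z powr p" using pos by (simp add: powr_mult_base)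
  finally have "f z \<le> f z powr p / s powr (p - 1)" using assms(3) by (simp add: pos_le_divide_eq)
  also have "\<dots> \<le> (\<Sum>z\<in>Z. f z powr p / s powr (p - 1))"
    using assms(1,2) by (intro member_le_sum[where f = "\<lambda>z. f z powr p / s powr (p - 1)"]) simp_all
  finally show ?thesis using assms(3) by linarith
qed

section \<open>Markov's inequality for the support function of the centroid body\<close>

context volume_one_body
begin

lemma centroid_fun_measurable: "(\<lambda>x. centroid_fun n q K x) \<in> borel_measurable unif"
proof -
  interpret sigma_finite_measure "leb n" by (rule sigma_finite_leb)
  have "(\<lambda>w. vinner n (snd w) (fst w)) \<in> borel_measurable (leb n \<Otimes>\<^sub>M leb n)"
    unfolding vinner_def leb_def by measurable
  then have "(\<lambda>(y, x). indicator K x *\<^sub>R (\<bar>vinner n x y\<bar> powr q)) \<in> borel_measurable (leb n \<Otimes>\<^sub>M leb n)"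
    using K_sets by (simp add: split_beta) measurable
  then have "(\<lambda>y. \<integral>x. indicator K x *\<^sub>R (\<bar>vinner n x y\<bar> powr q) \<partial>leb n) \<in> borel_measurable (leb n)"
    by (rule borel_measurable_lebesgue_integral)
  then have "(\<lambda>x. centroid_fun n q K x) \<in> borel_measurable (leb n)"
    unfolding centroid_fun_def set_lebesgue_integral_def by measurable
  then show ?thesis by (rule measurable_unif)
qed

lemma centroid_fun_bounded:
  assumes "q \<ge> 1"
  obtains B where "\<And>y. y \<in> K \<Longrightarrow> \<bar>centroid_fun n q K y\<bar> \<le> B"
proof -
  obtain R where R: "0 \<le> R" "\<And>x i. x \<in> K \<Longrightarrow> i < n \<Longrightarrow> \<bar>x i\<bar> \<le> R"
    using K_in_cube by blast
  have v: "\<bar>vinner n x y\<bar> \<le> n * R\<^sup>2" if "x \<in> K" "y \<in> K" for x y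
  proof -
    have "\<bar>vinner n x y\<bar> \<le> (\<Sum>i<n. R * R)"
      unfolding vinner_def using R that
      by (intro order_trans[OF sum_abs] sum_mono) (auto simp: abs_mult intro!: mult_mono)
    then show ?thesis by (simp add: power2_eq_square)
  qed
  have "\<bar>centroid_fun n q K y\<bar> \<le> ((n * R\<^sup>2) powr q) powr (1 / q)" if "y \<in> K" for y
  proof -
    have "(\<integral>x. \<bar>vinner n x y\<bar> powr q \<partial>unif) \<le> (\<integral>x. (n * R\<^sup>2) powr q \<partial>unif)"
      using v that assms
      by (intro integral_mono integrable_vinner_powr_unif) (auto simp: space_unif intro!: powr_mono2)
    also have "\<dots> = (n * R\<^sup>2) powr q" by (simp add: space_unif measure_space_unif)
    finally have "centroid_fun n q K y \<le> ((n * R\<^sup>2) powr q) powr (1 / q)"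
      unfolding centroid_fun_eq using assms by (intro powr_mono2) (auto intro: integral_nonneg_AE)
    then show ?thesis using centroid_fun_nonneg[of n q K y] by simp
  qed
  then show ?thesis by (rule that)
qed

lemma I1_eq: "q \<ge> 1 \<Longrightarrow> I1 n K (polar n (centroid_body n q K)) = (\<integral>x. centroid_fun n q K x \<partial>unif)"
  by (simp add: I1_polar_centroid_body[OF body volume] set_integral_eq)

text \<open>Taking \<open>J\<close> strictly above the mean of the nonnegative function
  \<open>centroid_fun n q K\<close> makes \<open>J\<close> positive, so it can be cancelled.\<close>

lemma centroid_fun_markov:
  assumes q: "q \<ge> 1" and J: "I1 n K (polar n (centroid_body n q K)) < J" and M: "M > 0"
  shows "measure unif {x \<in> K. M * J < centroid_fun n q K x} \<le> 1 / M"
proof -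
  let ?h = "centroid_fun n q K" and ?S = "{x \<in> K. M * J < centroid_fun n q K x}"
  have S: "?S \<in> sets unif"
    using borel_measurable_less[OF borel_measurable_const centroid_fun_measurable, of "M * J" q]
    by (simp only: space_unif)
  obtain B where B: "\<And>y. y \<in> K \<Longrightarrow> \<bar>?h y\<bar> \<le> B" using centroid_fun_bounded[OF q] by blast
  have I: "(\<integral>x. ?h x \<partial>unif) < J" using J I1_eq[OF q] by simp
  have I0: "0 \<le> (\<integral>x. ?h x \<partial>unif)" by (simp add: centroid_fun_nonneg)
  have "M * J * measure unif ?S = (\<integral>x. M * J * indicator ?S x \<partial>unif)"
    using S by simp
  also have "\<dots> \<le> (\<integral>x. ?h x \<partial>unif)"
  proof (intro integral_mono)
    show "integrable unif (\<lambda>x. M * J * indicator ?S x)"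
      using S by (auto simp: emeasure_eq_measure)
    show "integrable unif (\<lambda>x. ?h x)"
      by (rule integrable_unif[OF centroid_fun_measurable B])
  qed (auto simp: indicator_def centroid_fun_nonneg)
  also have "\<dots> \<le> J" using I by simp
  finally have "J * (M * measure unif ?S) \<le> J * 1" by (simp add: ac_simps)
  moreover have "J > 0" using I I0 by linarith
  ultimately have "M * measure unif ?S \<le> 1" by (simp only: mult_le_cancel_left_pos)
  then show ?thesis using M by (simp add: field_simps)
qed

end

section \<open>Moments of the Euclidean norm on an isotropic body\<close>

locale isotropic_body = volume_one_body +
  fixes L :: real
  assumes dim_pos: "n \<ge> 1" and iso: "has_isotropic_const n K L"
begin

lemma L_pos: "L > 0"
  using iso by (simp add: has_isotropic_const_def)

lemma integral_coord_power2: "i < n \<Longrightarrow> (\<integral>x. (x i)\<^sup>2 \<partial>unif) = L\<^sup>2"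
  using iso[unfolded has_isotropic_const_def, THEN conjunct2, rule_format, OF basis_vec_unit_sphere]
  by (simp add: set_integral_eq vinner_basis_vec)

lemma coord_measurable_unif: "i < n \<Longrightarrow> (\<lambda>x. x i) \<in> borel_measurable unif"
  by (rule measurable_unif[OF coord_measurable])

lemma integrable_coord_power:
  assumes "i < n"
  shows "integrable unif (\<lambda>x. (x i) ^ k)"
proof -
  obtain R where "0 \<le> R" and R: "\<And>x i. x \<in> K \<Longrightarrow> i < n \<Longrightarrow> \<bar>x i\<bar> \<le> R"
    using K_in_cube by blast
  show ?thesis
  proof (rule integrable_unif)
    show "(\<lambda>x. (x i) ^ k) \<in> borel_measurable unif"
      by (rule borel_measurable_power[OF coord_measurable_unif[OF assms]])
    show "\<bar>(x i) ^ k\<bar> \<le> R ^ k" if "x \<in> K" for x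
      unfolding power_abs by (rule power_mono[OF R[OF that assms] abs_ge_zero])
  qed
qed

text \<open>Isotropy says that \<open>centroid_fun\<close> with exponent 2 equals \<open>L\<close>
  at a basis vector; going to exponent 4 costs \<open>72 * (4 / 2) = 144\<close>.\<close>

lemma integral_coord_power4:
  assumes "i < n"
  shows "(\<integral>x. (x i) ^ 4 \<partial>unif) \<le> (144 * L) ^ 4"
proof -
  let ?e = "basis_vec n i"
  have p: "\<bar>x i\<bar> powr 2 = (x i)\<^sup>2" "\<bar>x i\<bar> powr 4 = (x i) ^ 4" for x :: "nat \<Rightarrow> real"
    using powr_realpow'[of "\<bar>x i\<bar>" 2] powr_realpow'[of "\<bar>x i\<bar>" 4] by auto
  have "centroid_fun n 2 K ?e = (L\<^sup>2) powr (1/2)"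
    using assms by (simp add: centroid_fun_eq vinner_basis_vec p integral_coord_power2)
  also have "\<dots> = L" using L_pos by (simp add: powr_half_sqrt)
  finally have "centroid_fun n 4 K ?e \<le> 144 * L"
    using centroid_fun_reverse_holder[of 2 4 ?e] by simp
  then have "centroid_fun n 4 K ?e powr 4 \<le> (144 * L) powr 4"
    by (intro powr_mono2 centroid_fun_nonneg) auto
  then show ?thesis
    using L_pos centroid_fun_powr_eq[of 4 ?e] assms
    by (simp add: vinner_basis_vec p)
qed

lemma integrable_sqnorm: "integrable unif (sqnorm n)"
  unfolding sqnorm_def[abs_def] by (intro Bochner_Integration.integrable_sum integrable_coord_power) auto

lemma integral_sqnorm: "(\<integral>x. sqnorm n x \<partial>unif) = n * L\<^sup>2"
  unfolding sqnorm_def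
  by (subst Bochner_Integration.integral_sum) (auto simp: integral_coord_power2 intro: integrable_coord_power)

lemma sqnorm_measurable: "sqnorm n \<in> borel_measurable unif"
  using integrable_sqnorm by auto

lemma integrable_sqnorm_power2: "integrable unif (\<lambda>x. (sqnorm n x)\<^sup>2)"
proof -
  have int: "integrable unif (\<lambda>x. n * (\<Sum>i<n. (x i) ^ 4))"
    by (intro integrable_mult_right Bochner_Integration.integrable_sum integrable_coord_power) auto
  show ?thesis
    by (rule Bochner_Integration.integrable_bound[OF int])
      (use sqnorm_measurable in \<open>auto simp: sum_nonneg intro: order_trans[OF sqnorm_power2_le]\<close>)
qed

lemma integral_sqnorm_power2: "(\<integral>x. (sqnorm n x)\<^sup>2 \<partial>unif) \<le> 144 ^ 4 * (n * L\<^sup>2)\<^sup>2"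
proof -
  have "(\<integral>x. (sqnorm n x)\<^sup>2 \<partial>unif) \<le> (\<integral>x. n * (\<Sum>i<n. (x i) ^ 4) \<partial>unif)"
    by (intro integral_mono integrable_sqnorm_power2 integrable_mult_right
        Bochner_Integration.integrable_sum integrable_coord_power sqnorm_power2_le) auto
  also have "\<dots> = n * (\<Sum>i<n. (\<integral>x. (x i) ^ 4 \<partial>unif))"
    by (simp add: Bochner_Integration.integral_sum integrable_coord_power)
  also have "\<dots> \<le> n * (\<Sum>i<n. (144 * L) ^ 4)"
    by (intro mult_left_mono sum_mono integral_coord_power4) auto
  also have "\<dots> = 144 ^ 4 * (n * L\<^sup>2)\<^sup>2"
    by (simp add: power_mult_distrib power2_eq_square power4_eq_xxxx)
  finally show ?thesis .
qed

text \<open>Outside \<open>A\<close> the squared norm is at most \<open>s\<close> plus its square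
  over \<open>s\<close>. The first part is small by the measure of \<open>K - A\<close>, the second
  by the fourth moment.\<close>

lemma integral_sqnorm_large_set:
  assumes A: "A \<in> sets unif" and small: "measure unif (K - A) \<le> 1 / (16 * 144 ^ 4)"
  shows "n * L\<^sup>2 / 2 \<le> (\<integral>x. indicator A x * sqnorm n x \<partial>unif)"
proof -
  \<comment> \<open>With this \<open>s\<close> each of the two losses is at most
    \<open>n * L\<^sup>2 / 4\<close>.\<close>
  define s where "s = 4 * 144 ^ 4 * (n * L\<^sup>2)"
  have nL: "n * L\<^sup>2 > 0" using L_pos dim_pos by simp
  then have s: "s > 0" by (simp add: s_def)
  have KA: "K - A \<in> sets unif" using A sets.compl_sets[OF A] by (simp add: space_unif)
  have iA: "integrable unif (\<lambda>x. indicator A x * sqnorm n x)"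
    using integrable_real_mult_indicator[OF A integrable_sqnorm] by (simp add: mult.commute)
  have iKA: "integrable unif (\<lambda>x. s * indicator (K - A) x)"
    using KA by (auto simp: emeasure_eq_measure)
  have "n * L\<^sup>2 \<le> (\<integral>x. (indicator A x * sqnorm n x + s * indicator (K - A) x) + (sqnorm n x)\<^sup>2 / s \<partial>unif)"
    unfolding integral_sqnorm[symmetric]
  proof (intro integral_mono Bochner_Integration.integrable_add integrable_divide integrable_sqnorm
      iA iKA integrable_sqnorm_power2)
    fix x assume "x \<in> space unif"
    then have x: "x \<in> K" by (simp add: space_unif)
    have "0 \<le> (sqnorm n x - s)\<^sup>2 / s" using s by simp
    then have "2 * sqnorm n x \<le> s + (sqnorm n x)\<^sup>2 / s"
      using s by (simp add: power2_eq_square field_simps)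
    then show "sqnorm n x \<le> indicator A x * sqnorm n x + s * indicator (K - A) x + (sqnorm n x)\<^sup>2 / s"
      using x s sqnorm_nonneg[of n x] by (cases "x \<in> A") auto
  qed
  also have "\<dots> = (\<integral>x. indicator A x * sqnorm n x \<partial>unif) + s * measure unif (K - A) + (\<integral>x. (sqnorm n x)\<^sup>2 \<partial>unif) / s"
  proof -
    have "(\<integral>x. s * indicator (K - A) x \<partial>unif) = s * measure unif (K - A)"
      using KA by simp
    then show ?thesis
      by (simp only: Bochner_Integration.integral_add[OF iA iKA] integral_divide_zero
          Bochner_Integration.integral_add[OF Bochner_Integration.integrable_add[OF iA iKA]
            integrable_divide[OF integrable_sqnorm_power2]])
  qed
  also have "\<dots> \<le> (\<integral>x. indicator A x * sqnorm n x \<partial>unif) + s * (1 / (16 * 144 ^ 4)) + 144 ^ 4 * (n * L\<^sup>2)\<^sup>2 / s"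
    using s small integral_sqnorm_power2 by (intro add_mono mult_left_mono divide_right_mono) auto
  also have "s * (1 / (16 * 144 ^ 4)) = n * L\<^sup>2 / 4" by (simp add: s_def)
  also have "144 ^ 4 * (n * L\<^sup>2)\<^sup>2 / s = n * L\<^sup>2 / 4" using nL by (simp add: s_def power2_eq_square)
  finally show ?thesis by (simp add: field_simps)
qed

end

section \<open>Comparison of the second moment with the mean norm\<close>

lemma exp_scaled_power_sum_le:
  fixes N D p :: real
  assumes "0 \<le> N" "N \<le> exp p" "0 < D"
  shows "N * (D powr p / (exp 1 * D) powr (p - 1)) \<le> exp 1 * D"
proof -
  have "D powr p / (exp 1 * D) powr (p - 1) = D / exp (p - 1)"
    using assms(3) by (simp add: powr_mult powr_diff) (simp add: powr_def exp_diff)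
  then have "N * (D powr p / (exp 1 * D) powr (p - 1)) = N * (D / exp (p - 1))" by simp
  also have "\<dots> \<le> exp p * (D / exp (p - 1))"
    using assms by (intro mult_right_mono) auto
  also have "\<dots> = exp 1 * D" by (simp add: exp_diff)
  finally show ?thesis .
qed

text \<open>
  The factor 24 comes from \<open>sqnorm_le_of_covering\<close>, 72 from \<open>centroid_fun_reverse_holder\<close>, and the last
  one is the reciprocal of the measure that may be discarded in \<open>integral_sqnorm_large_set\<close>.
\<close>

definition entropy_const :: real
  where "entropy_const = 24 * 72 * (16 * 144 ^ 4)"

context isotropic_body
begin

text \<open>On \<open>A\<close> the squared norm is, up to small errors, a product of
  \<open>x\<close> with one of at most \<open>exp p\<close> points of \<open>A\<close>. The maximum
  over these points has mean of order \<open>D\<close>, because \<open>p\<close>-th moments absorb a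
  union of \<open>exp p\<close> events at the cost of a constant.\<close>

lemma sqnorm_le_of_covering:
  fixes D p :: real
  assumes A: "A \<in> sets unif" "measure unif (K - A) \<le> 1 / (16 * 144 ^ 4)"
    and cov: "finite F" "A \<subseteq> (\<Union>c\<in>F. vadd n c ` vscale n (sqrt n * L / 8) ` unit_ball n)"
    and p: "p \<ge> 2" "card F \<le> exp p"
    and D: "D > 0" "\<And>z. z \<in> A \<Longrightarrow> centroid_fun n p K z \<le> D"
  shows "n * L\<^sup>2 \<le> 24 * D"
proof -
  define r where "r = sqrt n * L / 8"
  have r2: "8 * r\<^sup>2 = n * L\<^sup>2 / 8" by (simp add: r_def power_divide power_mult_distrib)
  have AK: "A \<subseteq> K" using sets.sets_into_space[OF A(1)] by (simp add: space_unif)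
  let ?B = "\<lambda>c. vadd n c ` vscale n r ` unit_ball n"
  \<comment> \<open>The bound \<open>D\<close> holds on \<open>A\<close> only, so every ball that
    meets \<open>A\<close> is represented by a point of \<open>A\<close> in it instead of its
    center.\<close>
  define G where "G = {c \<in> F. A \<inter> ?B c \<noteq> {}}"
  have "\<forall>c\<in>G. \<exists>z. z \<in> A \<inter> ?B c" by (auto simp: G_def)
  then obtain \<zeta> where \<zeta>: "\<And>c. c \<in> G \<Longrightarrow> \<zeta> c \<in> A \<inter> ?B c" by metis
  define Z where "Z = \<zeta> ` G"
  have G: "finite G" "card G \<le> card F" using cov(1) by (auto simp: G_def intro: card_mono)
  have Z: "finite Z" "Z \<subseteq> A" using G \<zeta> by (auto simp: Z_def)
  have "card Z \<le> card F" using card_image_le[OF G(1), of \<zeta>] G(2) by (simp add: Z_def)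
  then have cardZ: "card Z \<le> exp p" using p(2) by (meson of_nat_le_iff order_trans)
  \<comment> \<open>Each of the at most \<open>exp p\<close> points contributes at most
    \<open>D * exp (1 - p)\<close> to the integral, so at this threshold the whole sum is also at
    most \<open>exp 1 * D\<close>.\<close>
  define s where "s = exp 1 * D"
  have s: "s > 0" using D by (simp add: s_def)
  let ?S = "\<lambda>x. \<Sum>z\<in>Z. \<bar>vinner n x z\<bar> powr p / s powr (p - 1)"
  have pw: "indicator A x * sqnorm n x \<le> (s + n * L\<^sup>2 / 8) + ?S x + sqnorm n x / 8" for x
  proof (cases "x \<in> A")
    case True
    then obtain c where c: "c \<in> F" "x \<in> ?B c" using cov(2) by (auto simp: r_def)
    then have "c \<in> G" using True by (auto simp: G_def)
    have "sqnorm n x \<le> \<bar>vinner n x (\<zeta> c)\<bar> + sqnorm n x / 8 + 8 * r\<^sup>2"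
      using c(2) \<zeta>[OF \<open>c \<in> G\<close>] by (intro sqnorm_le_vinner_of_near[where c = c] mem_ball_translate) auto
    also have "\<bar>vinner n x (\<zeta> c)\<bar> \<le> s + ?S x"
      using le_threshold_add_sum_powr[OF Z(1), of "\<zeta> c" s p "\<lambda>z. \<bar>vinner n x z\<bar>"] s p \<open>c \<in> G\<close>
      by (auto simp: Z_def)
    finally show ?thesis using True r2 by simp
  next
    case False
    have "0 \<le> ?S x" by (intro sum_nonneg) auto
    then show ?thesis using False s sqnorm_nonneg[of n x] by simp
  qed
  have iA: "integrable unif (\<lambda>x. indicator A x * sqnorm n x)"
    using integrable_real_mult_indicator[OF A(1) integrable_sqnorm] by (simp add: mult.commute)
  have iS: "integrable unif ?S"
    using p by (intro Bochner_Integration.integrable_sum integrable_divide integrable_vinner_powr_unif) auto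
  have "n * L\<^sup>2 / 2 \<le> (\<integral>x. indicator A x * sqnorm n x \<partial>unif)"
    by (rule integral_sqnorm_large_set[OF A])
  also have "\<dots> \<le> (\<integral>x. (s + n * L\<^sup>2 / 8) + ?S x + sqnorm n x / 8 \<partial>unif)"
    by (intro integral_mono iA iS Bochner_Integration.integrable_add integrable_const integrable_divide integrable_sqnorm pw)
  also have "\<dots> = (s + n * L\<^sup>2 / 8) + (\<integral>x. ?S x \<partial>unif) + n * L\<^sup>2 / 8"
  proof -
    have "(\<integral>x. s + n * L\<^sup>2 / 8 \<partial>unif) = s + n * L\<^sup>2 / 8"
      by (simp add: space_unif measure_space_unif)
    then show ?thesis
      by (simp only: Bochner_Integration.integral_add[OF integrable_const iS] integral_divide_zero integral_sqnorm
          Bochner_Integration.integral_add[OF Bochner_Integration.integrable_add[OF integrable_const iS]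
            integrable_divide[OF integrable_sqnorm]])
  qed
  also have "(\<integral>x. ?S x \<partial>unif) = (\<Sum>z\<in>Z. (\<integral>x. \<bar>vinner n x z\<bar> powr p \<partial>unif) / s powr (p - 1))"
    using p by (subst Bochner_Integration.integral_sum) (auto intro!: integrable_vinner_powr_unif)
  also have "\<dots> \<le> (\<Sum>z\<in>Z. D powr p / s powr (p - 1))"
  proof (intro sum_mono divide_right_mono)
    fix z assume "z \<in> Z"
    then have "centroid_fun n p K z \<le> D" using D(2) Z(2) by blast
    then show "(\<integral>x. \<bar>vinner n x z\<bar> powr p \<partial>unif) \<le> D powr p"
      using p centroid_fun_nonneg[of n p K z] by (simp add: centroid_fun_powr_eq powr_mono2)
  qed auto
  also have "\<dots> = card Z * (D powr p / (exp 1 * D) powr (p - 1))"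
    by (simp add: s_def)
  also have "\<dots> \<le> exp 1 * D"
    using cardZ D by (intro exp_scaled_power_sum_le) auto
  \<comment> \<open>The distance error and the absorbed \<open>sqnorm n x / 8\<close> each take an
    eighth of \<open>n * L\<^sup>2\<close> from the half available.\<close>
  finally have "n * L\<^sup>2 / 4 \<le> 2 * (exp 1 * D)" by (simp add: s_def field_simps)
  also have "\<dots> \<le> 2 * (3 * D)" using e_less_272 D by (intro mult_left_mono mult_right_mono) auto
  finally show ?thesis by simp
qed

text \<open>Markov's inequality with \<open>M\<close> discards just the measure that
  \<open>integral_sqnorm_large_set\<close> allows; on the rest, reverse Hoelder bounds
  \<open>centroid_fun\<close> at exponent \<open>p\<close>.\<close>

lemma isotropic_const_le_I1:
  fixes q p :: real
  assumes q: "2 \<le> q" "q \<le> p"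
    and N: "covering_number n K K (vscale n (sqrt n * L / 8) ` unit_ball n) \<le> exp p"
  shows "n * L\<^sup>2 \<le> entropy_const * (p / q) * I1 n K (polar n (centroid_body n q K))"
proof -
  let ?I = "I1 n K (polar n (centroid_body n q K))"
  define M :: real where "M = 16 * 144 ^ 4"
  have r: "sqrt n * L / 8 > 0" using L_pos dim_pos by simp
  have "compactin (powertop_real {..<n}) K" using body by (simp add: convex_body_def)
  then obtain F where F: "finite F" "card F = covering_number n K K (vscale n (sqrt n * L / 8) ` unit_ball n)"
    "K \<subseteq> (\<Union>c\<in>F. vadd n c ` vscale n (sqrt n * L / 8) ` unit_ball n)"
    using compactin_covering_number[OF _ r] by metis
  have I0: "0 \<le> ?I" using q by (simp add: I1_eq centroid_fun_nonneg)
  have c: "entropy_const * (p / q) > 0" using q by (simp add: entropy_const_def)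
  have "n * L\<^sup>2 / (entropy_const * (p / q)) \<le> ?I"
  \<comment> \<open>Any \<open>J\<close> above the mean is positive, as the bound \<open>D\<close>
    of \<open>sqnorm_le_of_covering\<close> has to be; \<open>J\<close> then decreases to the
    mean.\<close>
  proof (rule dense_ge)
    fix J assume J: "?I < J"
    let ?A = "{x \<in> K. centroid_fun n q K x \<le> M * J}"
    have A: "?A \<in> sets unif"
      using borel_measurable_le[OF centroid_fun_measurable borel_measurable_const, of q "M * J"]
      by (simp only: space_unif)
    have "K - ?A = {x \<in> K. M * J < centroid_fun n q K x}" by auto
    then have small: "measure unif (K - ?A) \<le> 1 / (16 * 144 ^ 4)"
      using centroid_fun_markov[OF _ J, of M] q by (simp add: M_def)
    have "n * L\<^sup>2 \<le> 24 * (72 * (p / q) * (M * J))"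
    proof (rule sqnorm_le_of_covering[OF A small F(1)])
      show "?A \<subseteq> (\<Union>c\<in>F. vadd n c ` vscale n (sqrt n * L / 8) ` unit_ball n)"
        using F(3) by blast
      show "0 < 72 * (p / q) * (M * J)"
        using q J I0 by (intro mult_pos_pos) (auto simp: M_def)
      fix z assume "z \<in> {x \<in> K. centroid_fun n q K x \<le> M * J}"
      then have "72 * (p / q) * centroid_fun n q K z \<le> 72 * (p / q) * (M * J)"
        using q by (intro mult_left_mono) auto
      then show "centroid_fun n p K z \<le> 72 * (p / q) * (M * J)"
        using centroid_fun_reverse_holder[OF q, of z] by linarith
    qed (use q N F(2) in \<open>auto simp: M_def\<close>)
    also have "\<dots> = J * (entropy_const * (p / q))" by (simp add: entropy_const_def M_def)
    finally show "n * L\<^sup>2 / (entropy_const * (p / q)) \<le> J"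
      using c by (simp only: pos_divide_le_eq)
  qed
  then show ?thesis using c by (simp only: pos_divide_le_eq mult.commute)
qed

text \<open>The cases are whether the entropy estimate is available at radius
  \<open>sqrt n * L / 8\<close>. If it is, the second entry of the maximum bounds the squared
  constant; if not, the first does.\<close>

lemma isotropic_const_bound:
  fixes q \<kappa> \<tau> :: real
  assumes \<tau>: "1 \<le> \<tau>" "\<tau>\<^sup>2 \<le> ln n" and \<kappa>: "1 \<le> \<kappa>"
    and entropy: "\<And>t. \<tau> * sqrt (n * ln n) \<le> t \<Longrightarrow>
      ln (covering_number n K K (vscale n t ` unit_ball n)) \<le> \<kappa> * (real n)\<^sup>2 * (ln n)\<^sup>2 / t\<^sup>2"
    and q: "2 \<le> q" "q \<le> n"
    and I: "entropy_const * I1 n K (polar n (centroid_body n q K)) \<le> n * L\<^sup>2 / 2"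
  shows "L\<^sup>2 \<le> 64 * entropy_const * \<kappa> * sqrt (n / q) * (ln n)\<^sup>2 *
    max 1 (I1 n K (polar n (centroid_body n q K)) / (sqrt (q * n) * L\<^sup>2))"
proof -
  let ?I = "I1 n K (polar n (centroid_body n q K))"
  let ?r = "sqrt n * L / 8"
  let ?N = "covering_number n K K (vscale n ?r ` unit_ball n)"
  have n: "real n > 0" using dim_pos by simp
  have E: "entropy_const \<ge> 1" by (simp add: entropy_const_def)
  have "1\<^sup>2 \<le> \<tau>\<^sup>2" using \<tau>(1) by (intro power_mono) auto
  then have ln1: "ln n \<ge> 1" using \<tau>(2) by simp
  have I0: "0 \<le> ?I" using q by (simp add: I1_eq centroid_fun_nonneg)
  have nq: "1 \<le> sqrt (n / q)" using q by simp
  let ?c = "64 * entropy_const * \<kappa> * sqrt (n / q) * (ln n)\<^sup>2"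
  have c0: "?c \<ge> 0" using E \<kappa> nq by (intro mult_nonneg_nonneg) auto
  show ?thesis
  proof (cases "\<tau> * sqrt (n * ln n) \<le> ?r")
    case True
    \<comment> \<open>The least exponent allowed both by reverse Hoelder and by the size of the
      covering.\<close>
    define p where "p = max q (ln ?N)"
    have "?N \<le> exp p"
    proof (cases "?N = 0")
      case False
      then have "real ?N = exp (ln ?N)" by simp
      also have "\<dots> \<le> exp p" by (simp add: p_def)
      finally show ?thesis .
    qed simp
    then have le: "n * L\<^sup>2 \<le> entropy_const * (p / q) * ?I"
      using q by (intro isotropic_const_le_I1) (auto simp: p_def)
    have nL: "n * L\<^sup>2 > 0" using n L_pos by simp
    \<comment> \<open>For \<open>p = q\<close> the inequality \<open>le\<close> and the hypothesis
      \<open>I\<close> would give \<open>n * L\<^sup>2 \<le> n * L\<^sup>2 / 2\<close>. Hence the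
      entropy determines \<open>p\<close>.\<close>
    have "p \<noteq> q"
    proof
      assume "p = q"
      then have "n * L\<^sup>2 \<le> entropy_const * ?I" using le q(1) by simp
      then show False using I nL by linarith
    qed
    then have "p = ln ?N" unfolding p_def max_def by presburger
    also have "\<dots> \<le> \<kappa> * (real n)\<^sup>2 * (ln n)\<^sup>2 / ?r\<^sup>2" by (rule entropy[OF True])
    also have "\<dots> = 64 * \<kappa> * n * (ln n)\<^sup>2 / L\<^sup>2"
    proof -
      have "?r\<^sup>2 = n * L\<^sup>2 / 64" by (simp add: power_divide power_mult_distrib)
      then show ?thesis using n by (simp only:) (simp add: power2_eq_square[of "real n"])
    qed
    finally have p: "p \<le> 64 * \<kappa> * n * (ln n)\<^sup>2 / L\<^sup>2" .
    have "entropy_const * (p / q) * ?I \<le> entropy_const * (64 * \<kappa> * n * (ln n)\<^sup>2 / L\<^sup>2 / q) * ?I"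
      using p E q I0 by (intro mult_right_mono mult_left_mono divide_right_mono) auto
    also have "\<dots> = n * (64 * entropy_const * \<kappa> * (ln n)\<^sup>2 * (?I / (q * L\<^sup>2)))"
      by (simp add: mult_ac)
    finally have "n * L\<^sup>2 \<le> n * (64 * entropy_const * \<kappa> * (ln n)\<^sup>2 * (?I / (q * L\<^sup>2)))"
      using le by linarith
    then have "L\<^sup>2 \<le> 64 * entropy_const * \<kappa> * (ln n)\<^sup>2 * (?I / (q * L\<^sup>2))"
      using n by (simp only: mult_le_cancel_left_pos)
    \<comment> \<open>Splits \<open>1 / q\<close> as \<open>sqrt (n / q) / sqrt (q * n)\<close> to
      reach the quotient inside the maximum.\<close>
    also have "?I / (q * L\<^sup>2) = sqrt (n / q) * (?I / (sqrt (q * n) * L\<^sup>2))"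
      using n q by (simp add: real_sqrt_divide real_sqrt_mult)
    also have "64 * entropy_const * \<kappa> * (ln n)\<^sup>2 * (sqrt (n / q) * (?I / (sqrt (q * n) * L\<^sup>2)))
        = ?c * (?I / (sqrt (q * n) * L\<^sup>2))" by (simp only: ac_simps)
    also have "\<dots> \<le> ?c * max 1 (?I / (sqrt (q * n) * L\<^sup>2))"
      using c0 by (intro mult_left_mono) auto
    finally show ?thesis .
  next
    case False
    \<comment> \<open>A radius below the entropy range bounds \<open>L\<close> by
      \<open>8 * \<tau> * sqrt (ln n)\<close>; then \<open>\<tau>\<^sup>2 \<le> ln n\<close> removes
      \<open>\<tau>\<close> at the price of the second logarithm.\<close>
    then have "sqrt n * L < sqrt n * (8 * \<tau> * sqrt (ln n))"
      by (simp add: real_sqrt_mult mult_ac not_le)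
    then have "L < 8 * \<tau> * sqrt (ln n)" using n by simp
    then have "L\<^sup>2 \<le> (8 * \<tau> * sqrt (ln n))\<^sup>2" using L_pos by (intro power_mono) auto
    also have "\<dots> = 64 * (\<tau>\<^sup>2 * ln n)" using ln1 by (simp add: power_mult_distrib)
    also have "\<dots> \<le> 64 * (ln n * ln n)"
      using \<tau>(2) ln1 by (intro mult_left_mono mult_right_mono) auto
    also have "\<dots> = 64 * 1 * 1 * 1 * (ln n)\<^sup>2 * 1" by (simp add: power2_eq_square)
    also have "\<dots> \<le> ?c * max 1 (?I / (sqrt (q * n) * L\<^sup>2))"
      using E \<kappa> nq by (intro mult_mono) auto
    finally show ?thesis .
  qed
qed

end

section \<open>Choice of the absolute constants and of the least dimension\<close>

theorem theorem1p1:
  shows "\<exists>\<rho> C :: real. 0 < \<rho> \<and> \<rho> < 1 \<and> 0 < C \<and>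
    (\<forall>\<tau>\<ge>1. \<exists>n0 :: nat. \<forall>\<kappa>\<ge>1. \<forall>n\<ge>n0. \<forall>K. isotropic n K \<longrightarrow>
      (\<forall>t \<ge> \<tau> * sqrt (n * ln n).
        ln (covering_number n K K (vscale n t ` unit_ball n)) \<le> \<kappa> * n\<^sup>2 * (ln n)\<^sup>2 / t\<^sup>2) \<longrightarrow>
      (\<forall>q :: real. 2 \<le> q \<and> q \<le> \<rho>\<^sup>2 * n \<and>
          I1 n K (polar n (centroid_body n q K)) \<le> \<rho> * n * (isotropic_const n K)\<^sup>2 \<longrightarrow>
        (isotropic_const n K)\<^sup>2 \<le> C * \<kappa> * sqrt (n / q) * (ln n)\<^sup>2 *
          max 1 (I1 n K (polar n (centroid_body n q K)) / (sqrt (q * n) * (isotropic_const n K)\<^sup>2))))"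
proof -
  \<comment> \<open>Makes \<open>entropy_const\<close> times the hypothesis on \<open>I1\<close>
    read \<open>n * L\<^sup>2 / 2\<close>, which excludes \<open>p = q\<close>; as
    \<open>\<rho> < 1\<close>, it also gives \<open>q \<le> n\<close>.\<close>
  define \<rho> where "\<rho> = 1 / (2 * entropy_const)"
  have \<rho>: "0 < \<rho>" "\<rho> < 1" "entropy_const * \<rho> = 1 / 2" "0 < 64 * entropy_const"
    by (simp_all add: \<rho>_def entropy_const_def)
  show ?thesis
  proof (rule exI[of _ \<rho>], rule exI[of _ "64 * entropy_const"], intro conjI \<rho>(1,2,4) allI impI)
    fix \<tau> :: real assume \<tau>: "1 \<le> \<tau>"
    \<comment> \<open>Ensures \<open>\<tau>\<^sup>2 \<le> ln n\<close> for all later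
      \<open>n\<close>, and depends on \<open>\<tau>\<close> alone.\<close>
    obtain n0 :: nat where n0: "exp (\<tau>\<^sup>2) \<le> real n0" using real_arch_simple by blast
    show "\<exists>n0. \<forall>\<kappa>\<ge>1. \<forall>n\<ge>n0. \<forall>K. isotropic n K \<longrightarrow>
      (\<forall>t \<ge> \<tau> * sqrt (n * ln n).
        ln (covering_number n K K (vscale n t ` unit_ball n)) \<le> \<kappa> * n\<^sup>2 * (ln n)\<^sup>2 / t\<^sup>2) \<longrightarrow>
      (\<forall>q :: real. 2 \<le> q \<and> q \<le> \<rho>\<^sup>2 * n \<and>
          I1 n K (polar n (centroid_body n q K)) \<le> \<rho> * n * (isotropic_const n K)\<^sup>2 \<longrightarrow>
        (isotropic_const n K)\<^sup>2 \<le> 64 * entropy_const * \<kappa> * sqrt (n / q) * (ln n)\<^sup>2 *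
          max 1 (I1 n K (polar n (centroid_body n q K)) / (sqrt (q * n) * (isotropic_const n K)\<^sup>2)))"
    proof (intro exI[of _ n0] allI impI, elim conjE)
      fix \<kappa> :: real and n :: nat and K and q :: real
      assume \<kappa>: "1 \<le> \<kappa>" and n: "n0 \<le> n" and K: "isotropic n K"
        and entropy: "\<forall>t \<ge> \<tau> * sqrt (n * ln n).
          ln (covering_number n K K (vscale n t ` unit_ball n)) \<le> \<kappa> * (real n)\<^sup>2 * (ln n)\<^sup>2 / t\<^sup>2"
        and q: "2 \<le> q" "q \<le> \<rho>\<^sup>2 * n"
        and I: "I1 n K (polar n (centroid_body n q K)) \<le> \<rho> * n * (isotropic_const n K)\<^sup>2"
      have en: "exp (\<tau>\<^sup>2) \<le> n" using n0 n by (meson of_nat_le_iff order_trans)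
      then have n0': "real n > 0" by (rule less_le_trans[OF exp_gt_zero])
      then have n1: "n \<ge> 1" by simp
      have ln: "\<tau>\<^sup>2 \<le> ln n" using en n0' by (simp add: ln_ge_iff)
      obtain L where L: "has_isotropic_const n K L" using K unfolding isotropic_def by blast
      interpret isotropic_body n K L
        using K L n1 unfolding isotropic_def by unfold_locales blast+
      have "\<rho>\<^sup>2 * n \<le> 1 * real n" using \<rho>(1,2) by (intro mult_right_mono power_le_one) auto
      then have qn: "q \<le> n" using q(2) by simp
      have "entropy_const * I1 n K (polar n (centroid_body n q K)) \<le> entropy_const * (\<rho> * n * L\<^sup>2)"
        using I \<rho>(4) by (intro mult_left_mono) (auto simp: isotropic_const_eq[OF n1 L])
      also have "\<dots> = (entropy_const * \<rho>) * (n * L\<^sup>2)" by (simp only: ac_simps)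
      also have "\<dots> = n * L\<^sup>2 / 2" by (simp add: \<rho>(3))
      finally have I': "entropy_const * I1 n K (polar n (centroid_body n q K)) \<le> n * L\<^sup>2 / 2" .
      show "(isotropic_const n K)\<^sup>2 \<le> 64 * entropy_const * \<kappa> * sqrt (n / q) * (ln n)\<^sup>2 *
          max 1 (I1 n K (polar n (centroid_body n q K)) / (sqrt (q * n) * (isotropic_const n K)\<^sup>2))"
        unfolding isotropic_const_eq[OF n1 L]
        by (rule isotropic_const_bound[OF \<tau> ln \<kappa> entropy[rule_format] q(1) qn I'])
    qed
  qed
qed

end
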